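(* Let $\Gamma$ be a non-elementary hyperbolic group and let $\mathbf{D}=(\psi_1,\ldots,\psi_n)$ be a finite tuple of elements of $\mathcal{H}_\Gamma$. Then the translation cone $\mathcal{TC}(\mathbf{D})\subset\mathbb{R}^n$ is convex and it coincides with the asymptotic cone of $\mathbf{D}(\Gamma)\subset\mathbb{R}^n$. Moreover, $\mathcal{TC}(\mathbf{D})$ has non-empty interior in $\mathbb{R}^n$ if and only if $\psi_1,\ldots,\psi_n$ are independent.
   Context: A non-elementary hyperbolic group $\Gamma$ is a finitely generated group, not virtually cyclic, whose word metrics (for finite symmetric generating sets) are Gromov hyperbolic; $o$ is its identity. $\mathcal{D}_\Gamma$ is the set of left-invariant Gromov hyperbolic pseudo-metrics on $\Gamma$ that are quasi-isometric (via the identity map) to a word metric for a finite symmetric generating set. For $\psi:\Gamma\times\Gamma\to\mathbb{R}$ put $(x|y)_w^\psi=\frac12(\psi(x,w)+\psi(w,y)-\psi(x,y))$. $\mathcal{H}_\Gamma$ (hyperbolic metric potentials) is the real vector space of functions $\psi:\Gamma\times\Gamma\to\mathbb{R}$ such that (1) $\psi(sx,sy)=\psi(x,y)$ for all $x,y,s\in\Gamma$, and (2) for any $d_0\in\mathcal{D}_\Gamma$ there is $\lambda>0$ with $|(x|y)_w^\psi|\le\lambda (x|y)_w^{d_0}+\lambda$ for all $x,y,w\in\Gamma$. For $\psi\in\mathcal{H}_\Gamma$ the stable translation length is $\ell_\psi(x)=\lim_{m\to\infty}\psi(o,x^m)/m$ (the limit exists). For $\mathbf{D}=(\psi_1,\ldots,\psi_n)$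 we also write $\mathbf{D}(x)=(\psi_1(o,x),\ldots,\psi_n(o,x))$ and $\mathbf{\Lambda}(x)=(\ell_{\psi_1}(x),\ldots,\ell_{\psi_n}(x))$ for $x\in\Gamma$. The translation cone $\mathcal{TC}(\mathbf{D})$ is the closed cone in $\mathbb{R}^n$ generated by $\{\mathbf{\Lambda}(x):x\in\Gamma\}$, i.e. the closure of $\{t\mathbf{\Lambda}(x): t\ge 0, x\in\Gamma\}$. The asymptotic cone of a subset $T\subset\mathbb{R}^n$ is the set of $v\in\mathbb{R}^n$ for which there are positive reals $\alpha_k\to0$ and $t_k\in T$ with $\alpha_kt_k\to v$. $\psi_1,\ldots,\psi_k\in\mathcal{H}_\Gamma$ are independent if the only real constants $c_1,\ldots,c_k$ with $\sup_{x,y\in\Gamma}|\sum_i c_i\psi_i(x,y)|<\infty$ are $c_1=\cdots=c_k=0$. *)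

theory Defs
  imports "HOL-Analysis.Analysis" "HOL-Algebra.Elementary_Groups"
begin

text \<open>
  A function on \<open>\<Gamma> \<times> \<Gamma>\<close> is a curried function on the ambient type of the group record;
  only its values on \<^term>\<open>carrier G\<close> are ever constrained or used.
\<close>

section \<open>Gromov products and hyperbolicity\<close>

definition gromov_product :: "('a \<Rightarrow> 'a \<Rightarrow> real) \<Rightarrow> 'a \<Rightarrow> 'a \<Rightarrow> 'a \<Rightarrow> real" where
  "gromov_product \<psi> w x y = (\<psi> x w + \<psi> w y - \<psi> x y) / 2"

definition pseudo_metric_on :: "'a set \<Rightarrow> ('a \<Rightarrow> 'a \<Rightarrow> real) \<Rightarrow> bool" where
  "pseudo_metric_on X d \<longleftrightarrow>
     (\<forall>x\<in>X. \<forall>y\<in>X. 0 \<le> d x y) \<and>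
     (\<forall>x\<in>X. d x x = 0) \<and>
     (\<forall>x\<in>X. \<forall>y\<in>X. d x y = d y x) \<and>
     (\<forall>x\<in>X. \<forall>y\<in>X. \<forall>z\<in>X. d x z \<le> d x y + d y z)"

text \<open>Gromov's four-point condition, which also makes sense for non-geodesic pseudo-metrics.\<close>

definition gromov_hyperbolic_on :: "'a set \<Rightarrow> ('a \<Rightarrow> 'a \<Rightarrow> real) \<Rightarrow> bool" where
  "gromov_hyperbolic_on X d \<longleftrightarrow>
     (\<exists>\<delta>\<ge>0. \<forall>x\<in>X. \<forall>y\<in>X. \<forall>z\<in>X. \<forall>w\<in>X.
        gromov_product d w x z \<ge> min (gromov_product d w x y) (gromov_product d w y z) - \<delta>)"

text \<open>The identity map \<open>(X, d) \<rightarrow> (X, d')\<close> is a quasi-isometry.\<close>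

definition quasi_isometric_on :: "'a set \<Rightarrow> ('a \<Rightarrow> 'a \<Rightarrow> real) \<Rightarrow> ('a \<Rightarrow> 'a \<Rightarrow> real) \<Rightarrow> bool" where
  "quasi_isometric_on X d d' \<longleftrightarrow>
     (\<exists>L\<ge>1. \<exists>C\<ge>0. \<forall>x\<in>X. \<forall>y\<in>X.
        d x y / L - C \<le> d' x y \<and> d' x y \<le> L * d x y + C)"

definition left_invariant :: "('a, 'b) monoid_scheme \<Rightarrow> ('a \<Rightarrow> 'a \<Rightarrow> real) \<Rightarrow> bool" where
  "left_invariant G \<psi> \<longleftrightarrow>
     (\<forall>s\<in>carrier G. \<forall>x\<in>carrier G. \<forall>y\<in>carrier G.
        \<psi> (s \<otimes>\<^bsub>G\<^esub> x) (s \<otimes>\<^bsub>G\<^esub> y) = \<psi> x y)"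

section \<open>Word metrics and hyperbolic groups\<close>

definition finite_symmetric_generating_set :: "('a, 'b) monoid_scheme \<Rightarrow> 'a set \<Rightarrow> bool" where
  "finite_symmetric_generating_set G S \<longleftrightarrow>
     finite S \<and> S \<subseteq> carrier G \<and> (\<forall>s\<in>S. inv\<^bsub>G\<^esub> s \<in> S) \<and> generate G S = carrier G"

definition word_length :: "('a, 'b) monoid_scheme \<Rightarrow> 'a set \<Rightarrow> 'a \<Rightarrow> nat" where
  "word_length G S x =
     (LEAST n. \<exists>ws. length ws = n \<and> set ws \<subseteq> S \<and> foldr (\<otimes>\<^bsub>G\<^esub>) ws \<one>\<^bsub>G\<^esub> = x)"

definition word_metric :: "('a, 'b) monoid_scheme \<Rightarrow> 'a set \<Rightarrow> 'a \<Rightarrow> 'a \<Rightarrow> real" where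
  "word_metric G S x y = real (word_length G S (inv\<^bsub>G\<^esub> x \<otimes>\<^bsub>G\<^esub> y))"

definition virtually_cyclic :: "('a, 'b) monoid_scheme \<Rightarrow> bool" where
  "virtually_cyclic G \<longleftrightarrow>
     (\<exists>H. subgroup H G \<and> cyclic_group (G\<lparr>carrier := H\<rparr>) \<and> finite (rcosets\<^bsub>G\<^esub> H))"

definition nonelementary_hyperbolic_group :: "('a, 'b) monoid_scheme \<Rightarrow> bool" where
  "nonelementary_hyperbolic_group G \<longleftrightarrow>
     group G \<and>
     (\<exists>S. finite_symmetric_generating_set G S) \<and>
     (\<forall>S. finite_symmetric_generating_set G S \<longrightarrow>
        gromov_hyperbolic_on (carrier G) (word_metric G S)) \<and>
     \<not> virtually_cyclic G"

section \<open>Hyperbolic metric potentials\<close>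

definition hyperbolic_pseudo_metrics :: "('a, 'b) monoid_scheme \<Rightarrow> ('a \<Rightarrow> 'a \<Rightarrow> real) set" where
  "hyperbolic_pseudo_metrics G =
     {d. pseudo_metric_on (carrier G) d \<and> left_invariant G d \<and>
         gromov_hyperbolic_on (carrier G) d \<and>
         (\<exists>S. finite_symmetric_generating_set G S \<and>
              quasi_isometric_on (carrier G) (word_metric G S) d)}"

definition hyperbolic_metric_potentials :: "('a, 'b) monoid_scheme \<Rightarrow> ('a \<Rightarrow> 'a \<Rightarrow> real) set" where
  "hyperbolic_metric_potentials G =
     {\<psi>. left_invariant G \<psi> \<and>
         (\<forall>d\<in>hyperbolic_pseudo_metrics G. \<exists>c>0.
            \<forall>x\<in>carrier G. \<forall>y\<in>carrier G. \<forall>w\<in>carrier G.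
              \<bar>gromov_product \<psi> w x y\<bar> \<le> c * gromov_product d w x y + c)}"

definition stable_translation_length ::
  "('a, 'b) monoid_scheme \<Rightarrow> ('a \<Rightarrow> 'a \<Rightarrow> real) \<Rightarrow> 'a \<Rightarrow> real" where
  "stable_translation_length G \<psi> x =
     lim (\<lambda>m::nat. \<psi> \<one>\<^bsub>G\<^esub> (x [^]\<^bsub>G\<^esub> m) / real m)"

definition independent_potentials ::
  "('a, 'b) monoid_scheme \<Rightarrow> ('n::finite \<Rightarrow> 'a \<Rightarrow> 'a \<Rightarrow> real) \<Rightarrow> bool" where
  "independent_potentials G \<psi> \<longleftrightarrow>
     (\<forall>c :: 'n \<Rightarrow> real.
        bdd_above ((\<lambda>(x, y). \<bar>\<Sum>i\<in>UNIV. c i * \<psi> i x y\<bar>) ` (carrier G \<times> carrier G)) \<longrightarrow>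
        (\<forall>i. c i = 0))"

section \<open>The translation cone and the asymptotic cone\<close>

text \<open>An $n$-tuple is a family indexed by a finite type \<open>'n\<close> with $n$ elements.\<close>

definition potential_vector ::
  "('a, 'b) monoid_scheme \<Rightarrow> ('n::finite \<Rightarrow> 'a \<Rightarrow> 'a \<Rightarrow> real) \<Rightarrow> 'a \<Rightarrow> real ^ 'n" where
  "potential_vector G \<psi> x = (\<chi> i. \<psi> i \<one>\<^bsub>G\<^esub> x)"

definition translation_vector ::
  "('a, 'b) monoid_scheme \<Rightarrow> ('n::finite \<Rightarrow> 'a \<Rightarrow> 'a \<Rightarrow> real) \<Rightarrow> 'a \<Rightarrow> real ^ 'n" where
  "translation_vector G \<psi> x = (\<chi> i. stable_translation_length G (\<psi> i) x)"

definition translation_cone ::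
  "('a, 'b) monoid_scheme \<Rightarrow> ('n::finite \<Rightarrow> 'a \<Rightarrow> 'a \<Rightarrow> real) \<Rightarrow> (real ^ 'n) set" where
  "translation_cone G \<psi> =
     closure {t *\<^sub>R translation_vector G \<psi> x | t x. 0 \<le> t \<and> x \<in> carrier G}"

definition asymptotic_cone :: "'v::real_normed_vector set \<Rightarrow> 'v set" where
  "asymptotic_cone T =
     {v. \<exists>(\<alpha> :: nat \<Rightarrow> real) t. (\<forall>k. 0 < \<alpha> k) \<and> \<alpha> \<longlonglongrightarrow> 0 \<and> (\<forall>k. t k \<in> T) \<and>
         (\<lambda>k. \<alpha> k *\<^sub>R t k) \<longlonglongrightarrow> v}"

end

theory Submission
  imports Defs "HOL-Real_Asymp.Real_Asymp"
begin

text \<open>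
  By left invariance a potential \<open>\<psi>\<close> is determined by \<open>f x = \<psi> \<one> x\<close>, and the defining
  bound on its Gromov products says that \<open>f (x y) = f x + f y + O(1 + (x\<inverse>|y))\<close>: the
  function \<open>f\<close> is additive up to a bounded error along every product in which little
  cancels.  The theorem is therefore about producing products without cancellation, and
  two constructions suffice, each made once for all functions \<open>f\<close> simultaneously.

  \<^item> Joining: there is a map \<open>j\<close> with \<open>f (j x y) = f x + f y + O(1)\<close>
    (\<open>coarsely_additive_join\<close>).
  \<^item> Closing: there is a map \<open>\<kappa>\<close> such that the stable limit of \<open>f\<close> at \<open>\<kappa> x\<close> is
    \<open>f x + O(1)\<close> (\<open>coarsely_additive_close\<close>).

  Both insert a connecting element \<open>b\<close> of bounded length, \<open>j x y = x b y\<close> and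
  \<open>\<kappa> x = x b\<close> for long \<open>x\<close>, where \<open>b\<close> is taken from three elements pointing in pairwise different
  directions, with inverses that also do so.  Given \<open>x\<close> and \<open>y\<close>, one of the three does not
  follow \<open>x\<inverse>\<close> while its inverse does not follow \<open>y\<close> (\<open>exists_connector\<close>), and the
  local-to-global principle \<open>chain_step\<close> propagates the absence of cancellation along
  arbitrarily long products.  The three elements are \<open>g^n\<close>, \<open>g^(-n)\<close> and \<open>h g^n h\<inverse>\<close>,
  with \<open>g\<close> acting by translation along a quasi-axis and \<open>h\<close> moving that axis to a
  divergent one.  Such an \<open>h\<close> exists because the elements that fail to do so commensurate \<open>g\<close>
  (a pigeonhole argument, \<open>unbounded_gp_imp_commensurates_nat\<close>), hence stay near the axis
  (\<open>commensurator_near_axis\<close>), whereas the group is not virtually cyclic.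

  Closing shows that a limit of rescaled values of \<open>D\<close> is a limit of rescaled values of
  \<open>\<Lambda>\<close>; joining large powers of \<open>x\<close> and \<open>y\<close> shows that \<open>t \<Lambda>(x) + s \<Lambda>(y)\<close> lies in the
  asymptotic cone.  The two cones therefore agree and are convex.  A convex cone has empty
  interior exactly when it lies in a hyperplane \<open>c \<bullet> v = 0\<close> with \<open>c \<noteq> 0\<close>, that is, when the
  combination \<open>\<Sum>c\<^sub>i \<psi>\<^sub>i\<close> has vanishing stable limits; by closing, this happens exactly
  when the combination is bounded.
\<close>

section \<open>Lengths and Gromov products in a hyperbolic group\<close>

text \<open>
  The Gromov product at the identity of the left-invariant pseudo-metric
  \<open>(x, y) \<mapsto> len (x\<inverse> y)\<close>.
\<close>

definition length_product :: "('a, 'b) monoid_scheme \<Rightarrow> ('a \<Rightarrow> real) \<Rightarrow> 'a \<Rightarrow> 'a \<Rightarrow> real" where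
  "length_product G len x y = (len x + len y - len (inv\<^bsub>G\<^esub> x \<otimes>\<^bsub>G\<^esub> y)) / 2"

text \<open>
  Left invariance allows every base point to be translated to the identity, so a length
  function carries the whole geometry: all Gromov products below are based at \<open>\<one>\<close>, and
  the product of \<open>y\<close> and \<open>z\<close> at \<open>x\<close> is written as the product of \<open>x\<inverse> y\<close> and \<open>x\<inverse> z\<close>.
  In particular \<open>gp (inv x) y\<close> measures how much cancels in \<open>x \<otimes> y\<close>.
\<close>

locale hyperbolic_length_group = group G for G (structure) +
  fixes len :: "'a \<Rightarrow> real" and \<delta> :: real
  assumes len_one: "len \<one> = 0"
    and len_inv: "x \<in> carrier G \<Longrightarrow> len (inv x) = len x"
    and len_mult: "x \<in> carrier G \<Longrightarrow> y \<in> carrier G \<Longrightarrow> len (x \<otimes> y) \<le> len x + len y"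
    and finite_ball: "finite {x \<in> carrier G. len x \<le> r}"
    and delta_nonneg: "0 \<le> \<delta>"
    and hyperbolic: "x \<in> carrier G \<Longrightarrow> y \<in> carrier G \<Longrightarrow> z \<in> carrier G
      \<Longrightarrow> min (length_product G len x y) (length_product G len y z) - \<delta> \<le> length_product G len x z"
begin

abbreviation gp :: "'a \<Rightarrow> 'a \<Rightarrow> real" where
  "gp \<equiv> length_product G len"

lemmas gp_def = length_product_def

lemma len_nonneg: "x \<in> carrier G \<Longrightarrow> 0 \<le> len x"
  using len_mult[of x "inv x"] len_inv[of x] len_one by simp

lemma len_mult_ge:
  assumes "x \<in> carrier G" "y \<in> carrier G"
  shows "len x - len y \<le> len (x \<otimes> y)" "len y - len x \<le> len (x \<otimes> y)"
proof -
  have "x = (x \<otimes> y) \<otimes> inv y" "y = inv x \<otimes> (x \<otimes> y)"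
    using assms by (simp_all add: m_assoc inv_solve_left)
  then have "len x \<le> len (x \<otimes> y) + len (inv y)" "len y \<le> len (inv x) + len (x \<otimes> y)"
    using len_mult[of "x \<otimes> y" "inv y"] len_mult[of "inv x" "x \<otimes> y"] assms by auto
  then show "len x - len y \<le> len (x \<otimes> y)" "len y - len x \<le> len (x \<otimes> y)"
    using len_inv assms by auto
qed

lemma len_pow_le: "x \<in> carrier G \<Longrightarrow> len (x [^] (n::nat)) \<le> real n * len x"
proof (induction n)
  case 0
  then show ?case by (simp add: len_one)
next
  case (Suc n)
  then show ?case using len_mult[of "x [^] n" x] by (simp add: algebra_simps)
qed

lemma gp_commute:
  assumes "x \<in> carrier G" "y \<in> carrier G"
  shows "gp x y = gp y x"
  using len_inv[of "inv x \<otimes> y"] assms by (simp add: gp_def inv_mult_group)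

lemma gp_nonneg: "x \<in> carrier G \<Longrightarrow> y \<in> carrier G \<Longrightarrow> 0 \<le> gp x y"
  using len_mult[of "inv x" y] len_inv by (simp add: gp_def)

lemma gp_le:
  assumes "x \<in> carrier G" "y \<in> carrier G"
  shows "gp x y \<le> len x" "gp x y \<le> len y"
  using len_mult_ge[of "inv x" y] len_inv assms by (auto simp add: gp_def)

lemma gp_one: "x \<in> carrier G \<Longrightarrow> gp \<one> x = 0" "x \<in> carrier G \<Longrightarrow> gp x \<one> = 0"
  by (simp_all add: gp_def len_one len_inv)

lemma len_mult_eq:
  "x \<in> carrier G \<Longrightarrow> y \<in> carrier G \<Longrightarrow> len (x \<otimes> y) = len x + len y - 2 * gp (inv x) y"
  by (simp add: gp_def len_inv field_simps)

text \<open>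
  In a triangle with vertices \<open>\<one>\<close>, \<open>s\<close> and \<open>q\<close>, the Gromov products at \<open>\<one>\<close> and at \<open>s\<close>
  cut the side from \<open>\<one>\<close> to \<open>s\<close> into complementary pieces.
\<close>

lemma gp_switch:
  assumes "s \<in> carrier G" "q \<in> carrier G"
  shows "gp (inv s \<otimes> q) (inv s) = len s - gp q s"
proof -
  have "len (inv q \<otimes> s) = len (inv s \<otimes> q)"
    using len_inv[of "inv q \<otimes> s"] assms by (simp add: inv_mult_group)
  then show ?thesis
    using assms by (simp add: gp_def inv_mult_group m_assoc len_inv field_simps)
qed

lemma gp_perturb:
  assumes "x \<in> carrier G" "u \<in> carrier G" "y \<in> carrier G"
  shows "\<bar>gp (x \<otimes> u) y - gp x y\<bar> \<le> len u"
proof -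
  have "inv (x \<otimes> u) \<otimes> y = inv u \<otimes> (inv x \<otimes> y)"
    using assms by (simp add: inv_mult_group m_assoc)
  then show ?thesis
    using len_mult[of "inv u" "inv x \<otimes> y"] len_mult_ge[of "inv u" "inv x \<otimes> y"]
      len_mult[of x u] len_mult_ge[of x u] assms len_inv
    by (simp add: gp_def abs_le_iff field_simps)
qed

text \<open>
  The local-to-global principle, one letter at a time.  If \<open>s\<close> is long compared with
  what cancels between it and its neighbours, then the geodesic from the end of \<open>P \<otimes> s\<close>
  back to \<open>\<one>\<close> starts along \<open>s\<inverse>\<close>, for a length exceeding what \<open>t\<close> can
  follow of \<open>s\<inverse>\<close>; so \<open>t\<close> turns away from it.  The conclusion has the same shape as the
  hypothesis on \<open>P\<close>, hence the step can be iterated without loss in the constants.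
\<close>

lemma chain_step:
  assumes "P \<in> carrier G" "s \<in> carrier G" "t \<in> carrier G"
    and "gp (inv P) s \<le> a + \<delta>" "gp (inv s) t \<le> a" "2 * a + 2 * \<delta> < len s"
  shows "gp (inv (P \<otimes> s)) t \<le> a + \<delta>"
proof -
  have "gp (inv s) (inv (P \<otimes> s)) = len s - gp (inv P) s"
    using gp_switch[of s "inv P"] gp_commute[of "inv s" "inv s \<otimes> inv P"] assms
    by (simp add: inv_mult_group)
  then have "a + \<delta> < gp (inv s) (inv (P \<otimes> s))"
    using assms by simp
  moreover have "min (gp (inv s) (inv (P \<otimes> s))) (gp (inv (P \<otimes> s)) t) - \<delta> \<le> gp (inv s) t"
    using hyperbolic[of "inv s" "inv (P \<otimes> s)" t] assms by simp
  ultimately show ?thesis using assms(5) by linarith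
qed

section \<open>Elements with a quasi-axis\<close>

text \<open>
  The powers of \<open>g\<close> trace a quasi-geodesic line.  The lower bound on the length is
  normalised to slope one.
\<close>

definition axial :: "'a \<Rightarrow> real \<Rightarrow> bool" where
  "axial g K \<longleftrightarrow> g \<in> carrier G
     \<and> (\<forall>(m::nat) (n::nat). gp (inv (g [^] m)) (g [^] n) \<le> K) \<and> (\<forall>n :: nat. real n \<le> len (g [^] n))"

lemma axial_inv:
  assumes "axial g K" shows "axial (inv g) K"
  using assms unfolding axial_def
  by (auto simp: nat_pow_inv len_inv gp_commute[of "g [^] (_::nat)"])

text \<open>
  Long squares mean that little of \<open>y\<close> cancels in \<open>y \<otimes> y\<close>, namely less than half of its
  length; iterating \<open>chain_step\<close> then controls the cancellation in all products of powers.
\<close>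

lemma axial_if_square_long:
  assumes y: "y \<in> carrier G" and sq: "len y + 3 * \<delta> + 1 \<le> len (y \<otimes> y)"
  shows "\<exists>K. axial y K"
proof -
  define a where "a = gp (inv y) y"
  have a: "2 * a = 2 * len y - len (y \<otimes> y)"
    using y by (simp add: a_def gp_def len_inv)
  have leny: "2 * a + 3 * \<delta> + 1 \<le> len y" using a sq by simp
  \<comment> \<open>Stated for \<open>z\<close> so that it applies to both \<open>y\<close> and \<open>y\<inverse>\<close>.\<close>
  have one: "gp (inv (z [^] n)) z \<le> a + \<delta>"
    if z: "z \<in> carrier G" "gp (inv z) z = a" "len z = len y" for z and n :: nat
  proof (induction n)
    case 0
    then show ?case
      using z gp_nonneg[of "inv y" y] y delta_nonneg by (simp add: gp_one a_def)
  next
    case (Suc n)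
    then show ?case
      using chain_step[of "z [^] n" z z a] z leny delta_nonneg by simp
  qed
  have neg: "gp (y [^] n) (inv y) \<le> a + \<delta>" for n :: nat
    using one[of "inv y" n] y gp_commute[of y "inv y"] by (simp add: a_def len_inv nat_pow_inv)
  have two: "gp (inv (y [^] m)) (y [^] n) \<le> a + 2 * \<delta>" for m n :: nat
  proof (cases n)
    case 0
    then show ?thesis
      using gp_nonneg[of "inv y" y] y delta_nonneg by (simp add: gp_one a_def)
  next
    case (Suc k)
    have "y [^] n = y \<otimes> y [^] k" using Suc y nat_pow_Suc2 by auto
    then have "gp (y [^] n) y = len y - gp (y [^] k) (inv y)"
      using gp_switch[of "inv y" "y [^] k"] y by (simp add: len_inv)
    then have "a + 2 * \<delta> < gp (y [^] n) y" using neg[of k] leny delta_nonneg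
      using gp_nonneg[of "inv y" y] y by (simp add: a_def)
    moreover have "min (gp (inv (y [^] m)) (y [^] n)) (gp (y [^] n) y) - \<delta> \<le> a + \<delta>"
      using hyperbolic[of "inv (y [^] m)" "y [^] n" y] one[of y m] y by (simp add: a_def)
    ultimately show ?thesis by linarith
  qed
  have "real n \<le> len (y [^] n)" for n :: nat
  proof (induction n)
    case 0
    then show ?case by (simp add: len_one)
  next
    case (Suc n)
    have "len (y [^] Suc n) = len (y [^] n) + len y - 2 * gp (inv (y [^] n)) y"
      using len_mult_eq[of "y [^] n" y] y by simp
    then show ?case using Suc one[of y n] y leny delta_nonneg by (simp add: a_def)
  qed
  then show ?thesis using two y unfolding axial_def by blast
qed

text \<open>
  Every point \<open>g^i\<close> with \<open>i \<le> k\<close> is close to the geodesic from \<open>\<one>\<close> to \<open>g^k\<close>.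
\<close>

lemma axial_gp_nested:
  assumes "axial g K" "i \<le> k"
  shows "len (g [^] i) - K \<le> gp (g [^] (k::nat)) (g [^] i)"
proof -
  have g: "g \<in> carrier G" using assms by (simp add: axial_def)
  have "g [^] k = g [^] i \<otimes> g [^] (k - i)" using assms(2) nat_pow_mult[OF g, of i "k-i"] by simp
  then have "gp (g [^] k) (g [^] i) = len (g [^] i) - gp (g [^] (k - i)) (inv (g [^] i))"
    using gp_switch[of "inv (g [^] i)" "g [^] (k - i)"] g by (simp add: len_inv)
  then show ?thesis
    using assms(1) g gp_commute[of "g [^] (k - i)" "inv (g [^] i)"] by (simp add: axial_def)
qed

lemma len_int_pow:
  "g \<in> carrier G \<Longrightarrow> len (g [^] (q::int)) = len (g [^] nat \<bar>q\<bar>)"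
  by (cases q) (simp_all add: int_pow_int int_pow_neg_int len_inv flip: of_nat_Suc del: of_nat_Suc)

text \<open>
  Minimality of \<open>u\<close> bounds its product with one fixed power \<open>g^k\<close> by half of the length
  of \<open>g^k\<close>.  All higher powers share the initial segment up to \<open>g^k\<close>, so for \<open>g^k\<close> long
  enough hyperbolicity transfers the bound to them.
\<close>

lemma nearest_point_gp_nat:
  assumes ax: "axial g K"
  shows "\<exists>a. \<forall>u\<in>carrier G. (\<forall>m::nat. len u \<le> len (inv (g [^] m) \<otimes> u)) \<longrightarrow> (\<forall>n::nat. gp u (g [^] n) \<le> a)"
proof -
  have g: "g \<in> carrier G" using ax by (simp add: axial_def)
  obtain k :: nat where k: "2 * (K + \<delta>) < real k" using reals_Archimedean2 by blast
  have "real k \<le> len (g [^] k)" using ax by (simp add: axial_def)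
  with k have k': "2 * (K + \<delta>) < len (g [^] k)" by linarith
  show ?thesis
  proof (intro exI[of _ "real k * len g + \<delta>"] ballI impI allI)
    fix u and n :: nat
    assume u: "u \<in> carrier G" and min: "\<forall>m::nat. len u \<le> len (inv (g [^] m) \<otimes> u)"
    have half: "gp u (g [^] k) \<le> len (g [^] k) / 2"
    proof -
      have "len (inv u \<otimes> g [^] k) = len (inv (g [^] k) \<otimes> u)"
        using len_inv[of "inv u \<otimes> g [^] k"] u g by (simp add: inv_mult_group)
      then show ?thesis using min by (simp add: gp_def)
    qed
    show "gp u (g [^] n) \<le> real k * len g + \<delta>"
    proof (cases "k \<le> n")
      case True
      have "len (g [^] k) - K \<le> gp (g [^] n) (g [^] k)" using axial_gp_nested[OF ax True] .
      moreover have "min (gp u (g [^] n)) (gp (g [^] n) (g [^] k)) - \<delta> \<le> gp u (g [^] k)"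
        using hyperbolic u g by simp
      ultimately have "gp u (g [^] n) \<le> len (g [^] k) / 2 + \<delta>"
        using half k' by (cases "gp u (g [^] n) \<le> gp (g [^] n) (g [^] k)") (simp_all add: min_def)
      then show ?thesis using len_pow_le[OF g, of k] len_nonneg[of "g [^] k"] g by simp
    next
      case False
      have "gp u (g [^] n) \<le> real n * len g" using gp_le[of u "g [^] n"] len_pow_le[OF g, of n] u g by simp
      also have "\<dots> \<le> real k * len g" using False len_nonneg[OF g] by (intro mult_right_mono) auto
      finally show ?thesis using delta_nonneg by simp
    qed
  qed
qed

text \<open>
  An element whose nearest point on the axis is \<open>\<one>\<close> leaves the axis at a bounded distance
  from \<open>\<one>\<close>, in both directions.
\<close>

lemma nearest_point_gp:
  assumes ax: "axial g K"
  shows "\<exists>a. \<forall>u\<in>carrier G. (\<forall>m::int. len u \<le> len (g [^] m \<otimes> u)) \<longrightarrow> (\<forall>n::int. gp u (g [^] n) \<le> a)"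
proof -
  have g: "g \<in> carrier G" using ax by (simp add: axial_def)
  obtain a where a: "\<forall>u\<in>carrier G. (\<forall>m::nat. len u \<le> len (inv (g [^] m) \<otimes> u)) \<longrightarrow> (\<forall>n::nat. gp u (g [^] n) \<le> a)"
    using nearest_point_gp_nat[OF ax] by (rule exE)
  obtain b where b: "\<forall>u\<in>carrier G. (\<forall>m::nat. len u \<le> len (inv (inv g [^] m) \<otimes> u)) \<longrightarrow> (\<forall>n::nat. gp u (inv g [^] n) \<le> b)"
    using nearest_point_gp_nat[OF axial_inv[OF ax]] by (rule exE)
  show ?thesis
  proof (intro exI[of _ "max a b"] ballI impI allI)
    fix u and n :: int
    assume u: "u \<in> carrier G" and min: "\<forall>m::int. len u \<le> len (g [^] m \<otimes> u)"
    have pos: "\<forall>m::nat. len u \<le> len (inv (g [^] m) \<otimes> u)"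
    proof
      fix m :: nat
      show "len u \<le> len (inv (g [^] m) \<otimes> u)"
        using min[rule_format, of "- int m"] g by (simp add: int_pow_neg int_pow_int)
    qed
    have neg: "\<forall>m::nat. len u \<le> len (inv (inv g [^] m) \<otimes> u)"
    proof
      fix m :: nat
      show "len u \<le> len (inv (inv g [^] m) \<otimes> u)"
        using min[rule_format, of "int m"] g by (simp add: int_pow_int nat_pow_inv)
    qed
    note ab = mp[OF bspec[OF a u] pos, rule_format] mp[OF bspec[OF b u] neg, rule_format]
    show "gp u (g [^] n) \<le> max a b"
    proof (cases "n < 0")
      case True
      then have "g [^] n = inv g [^] nat (- n)" using g by (simp only: int_pow_def2 nat_pow_inv if_True)
      then show ?thesis using ab(2)[of "nat (-n)"] by simp
    next
      case False
      then have "g [^] n = g [^] nat n" by (simp only: int_pow_def2 if_False)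
      then show ?thesis using ab(1)[of "nat n"] by simp
    qed
  qed
qed

lemma nearest_point_exists:
  assumes "g \<in> carrier G" "x \<in> carrier G"
  shows "\<exists>(m::int) u. u \<in> carrier G \<and> x = g [^] m \<otimes> u \<and> (\<forall>j::int. len u \<le> len (g [^] j \<otimes> u))"
proof -
  define S where "S = {u \<in> carrier G. \<exists>m::int. x = g [^] m \<otimes> u} \<inter> {u \<in> carrier G. len u \<le> len x}"
  have fin: "finite S" unfolding S_def using finite_ball by blast
  have xS: "x \<in> S" using assms unfolding S_def by (auto intro!: exI[of _ "0::int"])
  define u where "u = arg_min_on len S"
  have u: "u \<in> S" "\<And>v. v \<in> S \<Longrightarrow> len u \<le> len v"
    using arg_min_if_finite[OF fin, of len] xS unfolding u_def by (auto simp: not_less)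
  then obtain m :: int where m: "u \<in> carrier G" "x = g [^] m \<otimes> u" unfolding S_def by blast
  have "len u \<le> len (g [^] j \<otimes> u)" for j :: int
  proof (cases "len (g [^] j \<otimes> u) \<le> len x")
    case True
    have "x = g [^] (m - j) \<otimes> (g [^] j \<otimes> u)"
      using m assms by (simp add: m_assoc[symmetric] int_pow_mult[symmetric])
    then have "g [^] j \<otimes> u \<in> S" using True m assms unfolding S_def by blast
    then show ?thesis using u(2) by blast
  next
    case False
    then show ?thesis using u(2)[OF xS] by simp
  qed
  then show ?thesis using m by blast
qed

section \<open>Translates of the axis\<close>

text \<open>
  If the ray \<open>x g^k\<close> follows the axis of \<open>g\<close> for a long time, then each early point
  \<open>x g^i\<close> is within a uniform distance of the axis, say \<open>x g^i = g^m u\<close> with \<open>u\<close> in a fixed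
  ball.  As this ball is finite, two exponents \<open>i < i'\<close> give the same \<open>u\<close>, and eliminating
  \<open>u\<close> yields the relation.
\<close>

lemma unbounded_gp_imp_commensurates_nat:
  assumes ax: "axial g K" and x: "x \<in> carrier G"
    and unb: "\<And>A. \<exists>(k::nat) (j::int). A < gp (x \<otimes> g [^] k) (g [^] j)"
  shows "\<exists>(p::nat) (q::int). 0 < p \<and> x \<otimes> g [^] p = g [^] q \<otimes> x"
proof -
  have g: "g \<in> carrier G" using ax by (simp add: axial_def)
  obtain a where a0: "\<forall>u\<in>carrier G. (\<forall>m::int. len u \<le> len (g [^] m \<otimes> u)) \<longrightarrow> (\<forall>n::int. gp u (g [^] n) \<le> a)"
    using nearest_point_gp[OF ax] by (rule exE)
  then have a: "gp u (g [^] n) \<le> a"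
    if "u \<in> carrier G" "\<forall>m::int. len u \<le> len (g [^] m \<otimes> u)" for u and n :: int
    using that by blast
  define c where "c = K + len x + \<delta>"
  define Ball where "Ball = {u \<in> carrier G. len u \<le> c + 2 * a}"
  have finB: "finite Ball" unfolding Ball_def by (rule finite_ball)
  define N where "N = card Ball"
  obtain k :: nat and j :: int where kj: "len x + real N * len g < gp (x \<otimes> g [^] k) (g [^] j)"
    using unb by blast
  have "\<exists>u\<in>Ball. \<exists>m::int. x \<otimes> g [^] i = g [^] m \<otimes> u" if i: "i \<le> N" for i :: nat
  proof -
    define P where "P = x \<otimes> g [^] i"
    have P: "P \<in> carrier G" using x g by (simp add: P_def)
    have "len P \<le> len x + real i * len g"
      unfolding P_def using len_mult[of x "g [^] i"] len_pow_le[OF g, of i] x g by simp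
    moreover have "real i * len g \<le> real N * len g" using i len_nonneg[OF g] by (intro mult_right_mono) auto
    ultimately have lenP: "len P < gp (x \<otimes> g [^] k) (g [^] j)" using kj by simp
    have ik: "i \<le> k"
    proof (rule ccontr)
      assume "\<not> i \<le> k"
      then have "real k * len g \<le> real N * len g" using i len_nonneg[OF g] by (intro mult_right_mono) auto
      moreover have "gp (x \<otimes> g [^] k) (g [^] j) \<le> len x + real k * len g"
        using gp_le[of "x \<otimes> g [^] k" "g [^] j"] len_mult[of x "g [^] k"] len_pow_le[OF g, of k] x g by simp
      ultimately show False using kj by simp
    qed
    have "x \<otimes> g [^] k = P \<otimes> g [^] (k - i)"
      using ik x g by (simp add: P_def m_assoc nat_pow_mult)
    then have "gp P (x \<otimes> g [^] k) = len P - gp (inv P) (g [^] (k - i))"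
      using gp_switch[of "inv P" "g [^] (k - i)"] P x g gp_commute[of P "x \<otimes> g [^] k"]
        gp_commute[of "inv P" "g [^] (k - i)"] by (simp add: len_inv)
    moreover have "gp (inv P) (g [^] (k - i)) \<le> K + len x"
    proof -
      have "gp (inv (g [^] i)) (g [^] (k - i)) \<le> K" using ax unfolding axial_def by blast
      moreover have "inv P = inv (g [^] i) \<otimes> inv x" using x g by (simp add: P_def inv_mult_group)
      ultimately show ?thesis
        using gp_perturb[of "inv (g [^] i)" "inv x" "g [^] (k - i)"] x g by (simp add: len_inv)
    qed
    moreover have "min (gp P (x \<otimes> g [^] k)) (gp (x \<otimes> g [^] k) (g [^] j)) - \<delta> \<le> gp P (g [^] j)"
      using hyperbolic P x g by simp
    \<comment> \<open>\<open>P\<close> is near the geodesic from \<open>\<one>\<close> to \<open>g^j\<close>; its projection \<open>g^m\<close> to the axis is then close to it.\<close>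
    ultimately have near: "len P - c \<le> gp P (g [^] j)"
      using lenP gp_nonneg[of "inv P" "g [^] (k - i)"] P g unfolding c_def by simp
    obtain m :: int and u where u: "u \<in> carrier G" "P = g [^] m \<otimes> u" "\<forall>j::int. len u \<le> len (g [^] j \<otimes> u)"
      using nearest_point_exists[OF g P] by blast
    have 1: "len P = len (g [^] m) + len u - 2 * gp (inv (g [^] m)) u"
      using len_mult_eq u g by simp
    have 2: "gp (inv (g [^] m)) u \<le> a"
      using a[OF u(1,3), of "-m"] u g gp_commute[of u "inv (g [^] m)"] by (simp add: int_pow_neg)
    have "inv P \<otimes> g [^] j = inv u \<otimes> g [^] (j - m)"
      using u g by (simp add: inv_mult_group m_assoc int_pow_neg[symmetric] int_pow_mult[symmetric])
    then have 3: "len (inv P \<otimes> g [^] j) = len u + len (g [^] (j - m)) - 2 * gp u (g [^] (j - m))"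
      using len_mult_eq[of "inv u" "g [^] (j - m)"] u g by (simp add: len_inv)
    have 4: "gp u (g [^] (j - m)) \<le> a" using a[OF u(1,3)] .
    have 5: "len (g [^] j) \<le> len (g [^] m) + len (g [^] (j - m))"
      using len_mult[of "g [^] m" "g [^] (j - m)"] g by (simp add: int_pow_mult[symmetric])
    have gpP: "2 * gp P (g [^] j) = len P + len (g [^] j) - len (inv P \<otimes> g [^] j)"
      by (simp add: gp_def)
    have "len u \<le> c + 2 * a"
      using near 1 2 3 4 5 gpP by linarith
    then show ?thesis using u unfolding Ball_def P_def by blast
  qed
  then have "\<forall>i\<in>{..N}. \<exists>u. u \<in> Ball \<and> (\<exists>m::int. x \<otimes> g [^] i = g [^] m \<otimes> u)"
    by blast
  from bchoice[OF this] obtain u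
    where u: "\<forall>i\<in>{..N}. u i \<in> Ball \<and> (\<exists>m::int. x \<otimes> g [^] i = g [^] m \<otimes> u i)"
    by (rule exE)
  have "u ` {..N} \<subseteq> Ball" using u by blast
  then have "card (u ` {..N}) < card {..N}"
    using card_mono[OF finB, of "u ` {..N}"] by (simp add: N_def)
  then have "\<not> inj_on u {..N}" by (rule pigeonhole)
  then obtain i i' where ii: "i < i'" "i \<le> N" "i' \<le> N" "u i = u i'"
    using linorder_inj_onI'[of "{..N}" u] by (meson atMost_iff)
  obtain m :: int where m: "x \<otimes> g [^] i = g [^] m \<otimes> u i"
    using bspec[OF u, of i] ii(2) by fastforce
  obtain m' :: int where m': "x \<otimes> g [^] i' = g [^] m' \<otimes> u i"
    unfolding ii(4) using bspec[OF u, of i'] ii(3) by fastforce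
  have uc: "u i \<in> carrier G" using bspec[OF u, of i] ii(2) by (simp add: Ball_def)
  have e: "x = g [^] m \<otimes> u i \<otimes> inv (g [^] i)"
    using m x g uc inv_solve_right[of x "g [^] m \<otimes> u i" "g [^] i"] by simp
  have "x \<otimes> g [^] (i' - i) = (x \<otimes> g [^] i') \<otimes> inv (g [^] i)"
    using ii x g inv_solve_right[of "x \<otimes> g [^] (i' - i)" "x \<otimes> g [^] i'" "g [^] i"]
    by (simp add: m_assoc nat_pow_mult)
  also have "\<dots> = g [^] (m' - m) \<otimes> (g [^] m \<otimes> u i \<otimes> inv (g [^] i))"
    unfolding m' using x g uc by (simp add: m_assoc[symmetric] int_pow_mult[symmetric])
  finally have "x \<otimes> g [^] (i' - i) = g [^] (m' - m) \<otimes> x"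
    unfolding e[symmetric] .
  then show ?thesis using ii(1) by (intro exI[of _ "i' - i"] exI[of _ "m' - m"]) simp
qed

lemma bounded_gp_if_not_commensurates:
  assumes ax: "axial g K" and x: "x \<in> carrier G"
    and nc: "\<And>(p::nat) (q::int). 0 < p \<Longrightarrow> x \<otimes> g [^] p \<noteq> g [^] q \<otimes> x"
  shows "\<exists>A. \<forall>(k::int) (j::int). gp (x \<otimes> g [^] k) (g [^] j) \<le> A"
proof -
  have g: "g \<in> carrier G" using ax by (simp add: axial_def)
  obtain A where A: "\<And>(k::nat) (j::int). gp (x \<otimes> g [^] k) (g [^] j) \<le> A"
  proof (rule ccontr)
    assume "\<not> thesis"
    with that have "\<exists>(k::nat) (j::int). A < gp (x \<otimes> g [^] k) (g [^] j)" for A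
      by (meson not_less)
    from unbounded_gp_imp_commensurates_nat[OF ax x this] show False using nc by blast
  qed
  have nc': "x \<otimes> inv g [^] p \<noteq> inv g [^] q \<otimes> x" if "0 < p" for p :: nat and q :: int
  proof
    assume h: "x \<otimes> inv g [^] p = inv g [^] q \<otimes> x"
    have "g [^] q \<otimes> x = g [^] q \<otimes> (x \<otimes> inv g [^] p) \<otimes> g [^] p"
      using x g by (simp add: nat_pow_inv m_assoc)
    also have "\<dots> = x \<otimes> g [^] p"
      unfolding h using x g by (simp add: int_pow_inv m_assoc[symmetric])
    finally show False using nc[OF that, of q] by simp
  qed
  obtain B where B: "\<And>(k::nat) (j::int). gp (x \<otimes> inv g [^] k) (inv g [^] j) \<le> B"
  proof (rule ccontr)
    assume "\<not> thesis"
    with that have "\<exists>(k::nat) (j::int). A < gp (x \<otimes> inv g [^] k) (inv g [^] j)" for A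
      by (meson not_less)
    from unbounded_gp_imp_commensurates_nat[OF axial_inv[OF ax] x this] show False using nc' by blast
  qed
  show ?thesis
  proof (intro exI[of _ "max A B"] allI)
    fix k j :: int
    show "gp (x \<otimes> g [^] k) (g [^] j) \<le> max A B"
    proof (cases "k < 0")
      case True
      then have "g [^] k = inv g [^] nat (- k)" using g by (simp only: int_pow_def2 nat_pow_inv if_True)
      moreover have "g [^] j = inv g [^] (- j)" using g by (simp add: int_pow_inv int_pow_neg)
      ultimately show ?thesis using B[of "nat (-k)" "-j"] by simp
    next
      case False
      then have "g [^] k = g [^] nat k" by (simp only: int_pow_def2 if_False)
      then show ?thesis using A[of "nat k" j] by simp
    qed
  qed
qed

text \<open>
  Used to compare exponents: the lengths of \<open>g^(i k)\<close> and \<open>g^(j k)\<close> drift apart as \<open>k\<close> grows.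
\<close>

lemma axial_growth:
  assumes ax: "axial g K" and ij: "i < j"
  shows "len (g [^] (i * k)) + real k - 2 * K \<le> len (g [^] (j * k :: nat))"
proof -
  have g: "g \<in> carrier G" using ax by (simp add: axial_def)
  have "i * k + (j - i) * k = j * k" using ij by (metis add_mult_distrib le_add_diff_inverse less_imp_le)
  then have "g [^] (j * k) = g [^] (i * k) \<otimes> g [^] ((j - i) * k)"
    using nat_pow_mult[OF g, of "i * k" "(j - i) * k"] by simp
  then have "len (g [^] (j * k)) = len (g [^] (i * k)) + len (g [^] ((j - i) * k))
      - 2 * gp (inv (g [^] (i * k))) (g [^] ((j - i) * k))"
    using len_mult_eq g by simp
  moreover have "real k \<le> real ((j - i) * k)" using mult_le_mono1[of 1 "j - i" k] ij
    by (simp only: of_nat_le_iff mult_1)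
  moreover have "real ((j - i) * k) \<le> len (g [^] ((j - i) * k))"
    "gp (inv (g [^] (i * k))) (g [^] ((j - i) * k)) \<le> K"
    using ax unfolding axial_def by blast+
  ultimately show ?thesis by linarith
qed

text \<open>
  From \<open>x g^(p k) = g^(q k) x\<close> the lengths of \<open>g^(p k)\<close> and \<open>g^(q k)\<close> differ by at most
  \<open>2 len x\<close>, which forces \<open>p = \<bar>q\<bar>\<close>, so that both lengths agree.  But \<open>x\<inverse> g^(q k) x\<close> is
  a product with bounded cancellation at both joints, so it is longer than \<open>g^(q k)\<close> by about
  \<open>2 len x\<close>.  Hence \<open>x\<close> is short.
\<close>

lemma commensurator_near_axis:
  assumes ax: "axial g K" and x: "x \<in> carrier G" 
    and a: "\<And>n::int. gp x (g [^] n) \<le> a"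
    and comm: "0 < p" "x \<otimes> g [^] (p::nat) = g [^] (q::int) \<otimes> x"
  shows "len x \<le> 2 * a + \<delta>"
proof -
  have g: "g \<in> carrier G" using ax by (simp add: axial_def)
  have a0: "0 \<le> a" using a[of 0] gp_nonneg[of x \<one>] x by simp
  define Q where "Q = nat \<bar>q\<bar>"
  have pows: "x \<otimes> g [^] (p * k) = g [^] (q * int k) \<otimes> x" for k :: nat
  proof (induction k)
    case 0
    then show ?case using x by simp
  next
    case (Suc k)
    have "x \<otimes> g [^] (p * Suc k) = x \<otimes> g [^] (p * k) \<otimes> g [^] p"
      using x g by (simp add: m_assoc nat_pow_mult add.commute)
    also have "\<dots> = g [^] (q * int k) \<otimes> (x \<otimes> g [^] p)"
      using Suc x g by (simp add: m_assoc)
    also have "\<dots> = g [^] (q * int (Suc k)) \<otimes> x"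
      using comm x g by (simp add: m_assoc[symmetric] int_pow_mult[symmetric] algebra_simps)
    finally show ?case .
  qed
  have lenq: "len (g [^] (q * int k)) = len (g [^] (Q * k))" for k :: nat
    using g by (simp add: len_int_pow Q_def abs_mult nat_mult_distrib)
  have conj: "g [^] (p * k) = inv x \<otimes> (g [^] (q * int k) \<otimes> x)" for k :: nat
    using pows[of k] x g inv_solve_left[of "g [^] (p * k)" x "g [^] (q * int k) \<otimes> x"] by simp
  have diff: "\<bar>len (g [^] (p * k)) - len (g [^] (Q * k))\<bar> \<le> 2 * len x" for k :: nat
  proof -
    have "len (g [^] (p * k) ) \<le> len (g [^] (q * int k)) + 2 * len x"
      unfolding conj using len_mult[of "inv x" "g [^] (q * int k) \<otimes> x"] len_mult[of "g [^] (q * int k)" x] x g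
      by (simp add: len_inv)
    moreover have "len (g [^] (q * int k)) - 2 * len x \<le> len (g [^] (p * k) )"
      unfolding conj using len_mult_ge[of "inv x" "g [^] (q * int k) \<otimes> x"] len_mult_ge[of "g [^] (q * int k)" x] x g
      by (simp add: len_inv)
    ultimately show ?thesis using lenq[of k] by simp
  qed
  obtain k0 :: nat where k0: "2 * K + 2 * len x + 2 * a + 2 * \<delta> < real k0" using reals_Archimedean2 by blast
  have K0: "0 \<le> K"
  proof -
    have "gp (inv (g [^] (0::nat))) (g [^] (0::nat)) \<le> K" using ax unfolding axial_def by blast
    then show ?thesis using gp_one by simp
  qed
  have "Q = p"
    using axial_growth[OF ax, of Q p k0] axial_growth[OF ax, of p Q k0] diff[of k0] k0 a0 delta_nonneg
    by (cases Q p rule: linorder_cases) (simp_all add: abs_le_iff)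
  define s where "s = g [^] (q * int k0)"
  have s: "s \<in> carrier G" using g by (simp add: s_def)
  have "real (p * k0) \<le> len (g [^] (p * k0))" using ax[unfolded axial_def] by (elim conjE) (erule spec)
  moreover have "real k0 \<le> real (p * k0)" using mult_le_mono1[of 1 p k0] comm(1)
    by (simp only: of_nat_le_iff mult_1)
  moreover have eq: "len s = len (g [^] (p * k0))" using lenq \<open>Q = p\<close> by (simp add: s_def)
  ultimately have "2 * a + 2 * \<delta> < len s" using k0 K0 len_nonneg[OF x] by simp
  moreover have xs: "gp x s \<le> a" "gp (inv s) x \<le> a"
    using a[of "q * int k0"] a[of "- (q * int k0)"] x g gp_commute[of x "inv s"]
    by (auto simp: s_def int_pow_neg)
  ultimately have "gp (inv (inv x \<otimes> s)) x \<le> a + \<delta>"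
    using chain_step[of "inv x" s x a] x s delta_nonneg by simp
  moreover have "len (g [^] (p * k0)) = len ((inv x \<otimes> s) \<otimes> x)"
    using conj[of k0] x s by (simp add: s_def m_assoc)
  moreover have "len ((inv x \<otimes> s) \<otimes> x) = len (inv x \<otimes> s) + len x - 2 * gp (inv (inv x \<otimes> s)) x"
    using len_mult_eq[of "inv x \<otimes> s" x] x s by blast
  moreover have "len (inv x \<otimes> s) = len x + len s - 2 * gp x s"
    using len_mult_eq[of "inv x" s] x s by (simp add: len_inv)
  ultimately show ?thesis using xs eq by linarith
qed

end

section \<open>Connecting elements\<close>

text \<open>
  The first assumption makes the length geodesic: an element can be split at every integer
  distance from \<open>\<one>\<close>.  The second assumption says that no cyclic subgroup is cobounded; with
  \<open>g = \<one>\<close> it says that the group is infinite.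
\<close>

locale nonelementary_length_group = hyperbolic_length_group +
  assumes geodesic_split: "x \<in> carrier G \<Longrightarrow> real k \<le> len x
      \<Longrightarrow> \<exists>y\<in>carrier G. \<exists>z\<in>carrier G. x = y \<otimes> z \<and> len y = real k \<and> len z = len x - real k"
    and far_from_cyclic: "g \<in> carrier G \<Longrightarrow> \<exists>x\<in>carrier G. \<forall>m::int. r < len (g [^] m \<otimes> x)"
begin

text \<open>
  Cut a geodesic word of length \<open>2 n\<close> in the middle, \<open>w = u v\<close>.  If neither \<open>u\<close> nor \<open>v\<close>
  has a long square, then \<open>u\<close> follows \<open>u\<inverse>\<close>, and \<open>v\<inverse>\<close> follows \<open>v\<close>, for almost half of
  their lengths.  As \<open>u\<inverse>\<close> and \<open>v\<close> point in opposite directions, so do \<open>u\<close> and \<open>v\<inverse>\<close>,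
  which are the first halves of \<open>w\<close> and \<open>w\<inverse>\<close>.  Then hardly anything cancels in \<open>w \<otimes> w\<close>.
\<close>

lemma exists_axial: "\<exists>g K. axial g K"
proof (rule ccontr)
  assume no: "\<not> ?thesis"
  obtain n :: nat where n: "8 * \<delta> + 2 < real n" using reals_Archimedean2 by blast
  obtain z where z: "z \<in> carrier G" "2 * real n < len z"
    using far_from_cyclic[of \<one> "2 * real n"] by auto
  obtain w where w: "w \<in> carrier G" "len w = 2 * real n"
    using geodesic_split[of z "2 * n"] z by auto
  obtain u v where uv: "u \<in> carrier G" "v \<in> carrier G" "w = u \<otimes> v" "len u = real n" "len v = real n"
    using geodesic_split[of w n] w by auto
  have short: "len y - 3 * \<delta> - 1 < 2 * gp (inv y) y" if "y \<in> carrier G" for y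
  proof -
    have "len (y \<otimes> y) < len y + 3 * \<delta> + 1"
      using axial_if_square_long[OF that] no by force
    then show ?thesis using len_mult_eq[OF that that] by simp
  qed
  have "gp (inv u) v = 0" using len_mult_eq[of u v] uv w by simp
  moreover have "min (gp (inv u) u) (gp u v) - \<delta> \<le> gp (inv u) v"
    "min (gp u (inv v)) (gp (inv v) v) - \<delta> \<le> gp u v"
    using hyperbolic uv by simp_all
  ultimately have 1: "gp u (inv v) \<le> 2 * \<delta>"
    using short[of u] short[of v] uv n delta_nonneg by (simp add: min_def split: if_splits)
  have "inv w \<otimes> u = inv v" "w \<otimes> inv v = u"
    using uv by (simp_all add: inv_mult_group m_assoc)
  then have "gp u w = real n" "gp (inv w) (inv v) = real n"
    using uv w gp_commute[of u w] by (simp_all add: gp_def len_inv)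
  moreover have "min (gp u w) (gp w (inv v)) - \<delta> \<le> gp u (inv v)"
    "min (gp w (inv w)) (gp (inv w) (inv v)) - \<delta> \<le> gp w (inv v)"
    using hyperbolic uv w by simp_all
  ultimately have "gp w (inv w) \<le> 4 * \<delta>"
    using 1 n delta_nonneg by (simp add: min_def split: if_splits)
  then show False
    using short[OF w(1)] gp_commute[of w "inv w"] w n delta_nonneg by simp
qed

text \<open>
  Take \<open>u\<close> far from the axis and shortest in its coset.  Elements commensurating \<open>g\<close> stay
  near the axis, so \<open>u\<close> is not one of them and its translate of the axis diverges from the
  axis in all four pairs of directions.
\<close>

lemma exists_independent_translate:
  "\<exists>g K x A. axial g K \<and> x \<in> carrier G \<and> (\<forall>(k::int) (j::int). gp (x \<otimes> g [^] k) (g [^] j) \<le> A)"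
proof -
  obtain g K where ax: "axial g K" using exists_axial by blast
  then have g: "g \<in> carrier G" by (simp add: axial_def)
  obtain a where a: "\<forall>u\<in>carrier G. (\<forall>m::int. len u \<le> len (g [^] m \<otimes> u)) \<longrightarrow> (\<forall>n::int. gp u (g [^] n) \<le> a)"
    using nearest_point_gp[OF ax] by (rule exE)
  obtain z where z: "z \<in> carrier G" "\<And>m::int. 2 * a + \<delta> < len (g [^] m \<otimes> z)"
    using far_from_cyclic[OF g, of "2 * a + \<delta>"] by blast
  obtain m :: int and u where u: "u \<in> carrier G" "z = g [^] m \<otimes> u" "\<forall>j::int. len u \<le> len (g [^] j \<otimes> u)"
    using nearest_point_exists[OF g z(1)] by blast
  have "g [^] (- m) \<otimes> z = u"
    using u g by (simp add: m_assoc[symmetric] int_pow_mult[symmetric])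
  then have "2 * a + \<delta> < len u" using z(2)[of "- m"] by simp
  moreover have "\<And>n::int. gp u (g [^] n) \<le> a" using a u by blast
  ultimately have "u \<otimes> g [^] p \<noteq> g [^] q \<otimes> u" if "0 < p" for p :: nat and q :: int
    using commensurator_near_axis[OF ax u(1) _ that] by (meson not_less)
  then show ?thesis using bounded_gp_if_not_commensurates[OF ax u(1)] ax u(1) by blast
qed

text \<open>
  The candidates \<open>g^n\<close>, \<open>g^(-n)\<close> and \<open>h g^n h\<inverse>\<close> have pairwise bounded Gromov products, and so
  have their inverses.  By hyperbolicity \<open>x\<close> follows at most one candidate and \<open>y\<close> at
  most one inverse, which leaves a suitable third.  The bound \<open>a\<close> is
  independent of \<open>n\<close>, so \<open>n\<close> can be chosen afterwards to make all candidates long.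
\<close>

lemma exists_connector:
  "\<exists>a R. \<forall>x\<in>carrier G. \<forall>y\<in>carrier G. \<exists>b\<in>carrier G.
     gp x b \<le> a \<and> gp (inv b) y \<le> a \<and> 2 * a + 2 * \<delta> < len b \<and> len b \<le> R"
proof -
  obtain g K h A where ax: "axial g K" and h: "h \<in> carrier G"
    and A: "\<And>(k::int) (j::int). gp (h \<otimes> g [^] k) (g [^] j) \<le> A"
    using exists_independent_translate by blast
  then have g: "g \<in> carrier G" by (simp add: axial_def)
  define a0 where "a0 = max K (A + len h)"
  define a where "a = a0 + \<delta>"
  obtain n :: nat where n: "2 * a + 2 * \<delta> + 2 * len h < real n" using reals_Archimedean2 by blast
  define b1 where "b1 = g [^] n"
  define b3 where "b3 = h \<otimes> b1 \<otimes> inv h"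
  have b: "b1 \<in> carrier G" "b3 \<in> carrier G" using g h by (simp_all add: b1_def b3_def)
  have ib3: "inv b3 = h \<otimes> inv b1 \<otimes> inv h"
    using b h by (simp add: b3_def inv_mult_group m_assoc)
  have "gp (inv b1) b1 \<le> K" using ax unfolding axial_def b1_def by blast
  then have K: "gp (inv b1) b1 \<le> a0" by (simp add: a0_def)
  have "b1 = g [^] int n" "inv b1 = g [^] (- int n)"
    using g by (simp_all add: b1_def int_pow_int int_pow_neg)
  then have "gp (h \<otimes> b1) b1 \<le> A" "gp (h \<otimes> inv b1) b1 \<le> A"
    "gp (h \<otimes> b1) (inv b1) \<le> A" "gp (h \<otimes> inv b1) (inv b1) \<le> A"
    using A by metis+
  then have far: "gp b3 b1 \<le> a0" "gp b3 (inv b1) \<le> a0" "gp (inv b3) b1 \<le> a0" "gp (inv b3) (inv b1) \<le> a0"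
    unfolding ib3 unfolding b3_def a0_def
    using gp_perturb[of "h \<otimes> b1" "inv h" b1] gp_perturb[of "h \<otimes> b1" "inv h" "inv b1"]
      gp_perturb[of "h \<otimes> inv b1" "inv h" b1] gp_perturb[of "h \<otimes> inv b1" "inv h" "inv b1"] b h
    by (simp_all add: len_inv)
  have "real n \<le> len b1" using ax by (simp add: axial_def b1_def)
  moreover have "len b1 - 2 * len h \<le> len b3"
    using len_mult_ge[of "h \<otimes> b1" "inv h"] len_mult_ge[of h b1] b h by (simp add: b3_def len_inv)
  ultimately have long: "2 * a + 2 * \<delta> < len b1" "2 * a + 2 * \<delta> < len b3"
    using n len_nonneg[OF h] by auto
  \<comment> \<open>No element follows two candidates whose mutual product is at most \<open>a0\<close>.\<close>
  have sep: "gp z u \<le> a \<or> gp z v \<le> a"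
    if "z \<in> carrier G" "u \<in> carrier G" "v \<in> carrier G" "gp u v \<le> a0" for z u v
    using hyperbolic[of u z v] that gp_commute[of u z] by (auto simp: a_def min_def split: if_splits)
  show ?thesis
  proof (rule exI[of _ a], rule exI[of _ "max (len b1) (len b3)"], intro ballI)
    fix x y
    assume xy: "x \<in> carrier G" "y \<in> carrier G"
    have "gp x b1 \<le> a \<or> gp x (inv b1) \<le> a" "gp x b3 \<le> a \<or> gp x b1 \<le> a" "gp x b3 \<le> a \<or> gp x (inv b1) \<le> a"
      "gp y b1 \<le> a \<or> gp y (inv b1) \<le> a" "gp y (inv b3) \<le> a \<or> gp y b1 \<le> a" "gp y (inv b3) \<le> a \<or> gp y (inv b1) \<le> a"
      using sep[OF xy(1), of "inv b1" b1] sep[OF xy(1), of b3 b1] sep[OF xy(1), of b3 "inv b1"]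
        sep[OF xy(2), of "inv b1" b1] sep[OF xy(2), of "inv b3" b1] sep[OF xy(2), of "inv b3" "inv b1"]
        far K b by auto
    then have "gp x b1 \<le> a \<and> gp y (inv b1) \<le> a \<or> gp x (inv b1) \<le> a \<and> gp y b1 \<le> a
        \<or> gp x b3 \<le> a \<and> gp y (inv b3) \<le> a" by blast
    then have "gp x b1 \<le> a \<and> gp (inv b1) y \<le> a \<or> gp x (inv b1) \<le> a \<and> gp (inv (inv b1)) y \<le> a
        \<or> gp x b3 \<le> a \<and> gp (inv b3) y \<le> a"
      using gp_commute[of y] xy b by simp
    then show "\<exists>b\<in>carrier G. gp x b \<le> a \<and> gp (inv b) y \<le> a \<and> 2 * a + 2 * \<delta> < len b
        \<and> len b \<le> max (len b1) (len b3)"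
      using long b len_inv[OF b(1)] by (metis inv_closed max.cobounded1 max.cobounded2)
  qed
qed

section \<open>Coarsely additive functions and their stable limits\<close>

text \<open>
  Comparing \<open>h (m n)\<close> with both \<open>n h(m)\<close> and \<open>m h(n)\<close> bounds the difference of
  \<open>h m / m\<close> and \<open>h n / n\<close> by \<open>2 C / m + 2 C / n\<close>.
\<close>

lemma convergent_if_almost_additive:
  fixes h :: "nat \<Rightarrow> real"
  assumes h: "\<And>m n. \<bar>h (m + n) - h m - h n\<bar> \<le> C"
  shows "convergent (\<lambda>n. h n / real n)"
proof -
  have C: "0 \<le> C" using h[of 0 0] by linarith
  have mult: "\<bar>h (n * m) - real n * h m\<bar> \<le> real (Suc n) * C" for n m
  proof (induction n)
    case 0
    then show ?case using h[of 0 0] by simp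
  next
    case (Suc n)
    then show ?case using h[of m "n * m"] by (simp add: algebra_simps abs_le_iff)
  qed
  \<comment> \<open>The error \<open>(n + 1) C\<close> is replaced by \<open>2 n C\<close> to leave a bound depending on \<open>m\<close> only.\<close>
  have quot: "\<bar>h (n * m) / real (n * m) - h m / real m\<bar> \<le> 2 * C / real m" if "0 < m" "0 < n" for m n
  proof -
    have "h (n * m) / real (n * m) - h m / real m = (h (n * m) - real n * h m) / real (n * m)"
      using that by (simp add: field_simps)
    also have "\<bar>\<dots>\<bar> \<le> (real (Suc n) * C) / real (n * m)"
      using mult[of n m] that by (simp add: abs_divide divide_right_mono del: of_nat_mult of_nat_Suc)
    also have "\<dots> \<le> (2 * real n * C) / real (n * m)"
      using that C by (intro divide_right_mono mult_right_mono) auto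
    also have "\<dots> = 2 * C / real m" using that by simp
    finally show ?thesis .
  qed
  have close: "\<bar>h m / real m - h n / real n\<bar> \<le> 2 * C / real m + 2 * C / real n" if "0 < m" "0 < n" for m n
    using quot[OF that] quot[OF that(2,1)] by (simp add: mult.commute[of n m])
  have "Cauchy (\<lambda>n. h n / real n)"
  proof (rule metric_CauchyI)
    fix e :: real
    assume e: "0 < e"
    obtain N :: nat where N: "4 * C / e < real N" using reals_Archimedean2 by blast
    have small: "2 * C / real m < e / 2" if "Suc N \<le> m" for m
    proof -
      have "4 * C / e < real m" using N that by simp
      then show ?thesis using e that by (simp add: field_simps)
    qed
    show "\<exists>M. \<forall>m\<ge>M. \<forall>n\<ge>M. dist (h m / real m) (h n / real n) < e"
    proof (intro exI[of _ "Suc N"] allI impI)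
      fix m n
      assume "Suc N \<le> m" "Suc N \<le> n"
      then show "dist (h m / real m) (h n / real n) < e"
        using close[of m n] small[of m] small[of n] by (simp add: dist_real_def)
    qed
  qed
  then show ?thesis by (simp add: Cauchy_convergent_iff)
qed

text \<open>
  The condition that membership in \<^const>\<open>hyperbolic_metric_potentials\<close> imposes on
  \<open>f x = \<psi> \<one> x\<close>, since \<open>f x + f y - f (x \<otimes> y)\<close> is twice the \<open>\<psi>\<close>-Gromov product of
  \<open>x\<inverse>\<close> and \<open>y\<close> at \<open>\<one>\<close>.
\<close>

definition coarsely_additive :: "('a \<Rightarrow> real) \<Rightarrow> bool" where
  "coarsely_additive f \<longleftrightarrow> (\<exists>c\<ge>0. \<forall>x\<in>carrier G. \<forall>y\<in>carrier G.
     \<bar>f (x \<otimes> y) - f x - f y\<bar> \<le> c * (1 + gp (inv x) y))"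

lemma coarsely_additive_bound:
  assumes c: "0 \<le> c" "\<And>x y. x \<in> carrier G \<Longrightarrow> y \<in> carrier G \<Longrightarrow> \<bar>f (x \<otimes> y) - f x - f y\<bar> \<le> c * (1 + gp (inv x) y)"
    and x: "x \<in> carrier G" and y: "y \<in> carrier G" and "gp (inv x) y \<le> K"
  shows "\<bar>f (x \<otimes> y) - f x - f y\<bar> \<le> c * (1 + K)"
proof -
  have "c * (1 + gp (inv x) y) \<le> c * (1 + K)" using assms by (intro mult_left_mono) auto
  then show ?thesis using c(2)[OF x y] by linarith
qed

lemma bounded_on_balls: "\<exists>B\<ge>0. \<forall>x\<in>carrier G. len x \<le> r \<longrightarrow> \<bar>f x :: real\<bar> \<le> B"
proof -
  have "finite ((\<lambda>x. \<bar>f x\<bar>) ` {x \<in> carrier G. len x \<le> r})" by (intro finite_imageI finite_ball)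
  then have "bdd_above ((\<lambda>x. \<bar>f x\<bar>) ` {x \<in> carrier G. len x \<le> r})" by (rule bdd_above_finite)
  then obtain B where "\<And>x. x \<in> carrier G \<Longrightarrow> len x \<le> r \<Longrightarrow> \<bar>f x\<bar> \<le> B"
    unfolding bdd_above_def by blast
  then have "\<forall>x\<in>carrier G. len x \<le> r \<longrightarrow> \<bar>f x\<bar> \<le> max B 0" by (simp add: max.coboundedI1)
  then show ?thesis by (intro exI[of _ "max B 0"]) simp
qed

text \<open>
  Split off one generator at a time; each step costs a bounded amount because at most the
  length of the generator can cancel.
\<close>

lemma coarsely_additive_linear_growth:
  assumes "coarsely_additive f"
  shows "\<exists>E\<ge>0. \<forall>x\<in>carrier G. \<bar>f x\<bar> \<le> E * (len x + 2)"
proof -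
  obtain c where c: "0 \<le> c" "\<And>x y. x \<in> carrier G \<Longrightarrow> y \<in> carrier G \<Longrightarrow> \<bar>f (x \<otimes> y) - f x - f y\<bar> \<le> c * (1 + gp (inv x) y)"
    using assms unfolding coarsely_additive_def by blast
  obtain M where M: "0 \<le> M" "\<And>x. x \<in> carrier G \<Longrightarrow> len x \<le> 1 \<Longrightarrow> \<bar>f x\<bar> \<le> M"
    using bounded_on_balls[of 1 f] by blast
  have ind: "\<bar>f x\<bar> \<le> (M + c * 2) * (real n + 1)" if "x \<in> carrier G" "len x \<le> real n" for x n
    using that
  proof (induction n arbitrary: x)
    case 0
    then show ?case using M(2)[of x] c by simp
  next
    case (Suc n)
    show ?case
    proof (cases "len x \<le> 1")
      case True
      have "M * 1 \<le> (M + c * 2) * (real (Suc n) + 1)" using M(1) c(1) by (intro mult_mono) auto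
      then show ?thesis using M(2)[of x] Suc True by simp
    next
      case False
      then obtain y z where yz: "y \<in> carrier G" "z \<in> carrier G" "x = y \<otimes> z" "len y = 1" "len z = len x - 1"
        using geodesic_split[of x 1, OF Suc.prems(1)] by auto
      have "gp (inv y) z \<le> 1" using yz(1,2,4) gp_le(1)[of "inv y" z] len_inv[of y] by simp
      then have "\<bar>f (y \<otimes> z) - f y - f z\<bar> \<le> c * (1 + 1)"
        using yz(1,2) by (intro coarsely_additive_bound[OF c])
      moreover have "\<bar>f z\<bar> \<le> (M + c * 2) * (real n + 1)" using Suc.IH[OF yz(2)] Suc.prems(2) yz(5) by simp
      moreover have "\<bar>f y\<bar> \<le> M" using M yz by simp
      moreover have "\<bar>f x\<bar> \<le> \<bar>f (y \<otimes> z) - f y - f z\<bar> + \<bar>f y\<bar> + \<bar>f z\<bar>"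
        unfolding yz(3) by linarith
      ultimately have "\<bar>f x\<bar> \<le> (M + c * 2) + (M + c * 2) * (real n + 1)"
        by simp
      then show ?thesis by (simp add: algebra_simps)
    qed
  qed
  show ?thesis
  proof (intro exI[of _ "M + c * 2"] conjI ballI)
    show "0 \<le> M + c * 2" using M c by simp
    fix x assume x: "x \<in> carrier G"
    have "\<bar>f x\<bar> \<le> (M + c * 2) * (real (nat \<lceil>len x\<rceil>) + 1)"
      by (intro ind x real_nat_ceiling_ge)
    also have "\<dots> \<le> (M + c * 2) * (len x + 2)"
      using M(1) c(1) len_nonneg[OF x] by (intro mult_left_mono) linarith+
    finally show "\<bar>f x\<bar> \<le> (M + c * 2) * (len x + 2)" .
  qed
qed

text \<open>
  Every power of \<open>x\<close> is a power of \<open>x^N\<close> up to a remainder of bounded length.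
\<close>

lemma axial_power_gp_bounded:
  fixes m n N :: nat
  assumes ax: "axial (x [^] N) K" and x: "x \<in> carrier G" and N: "0 < N"
  shows "gp (inv (x [^] m)) (x [^] n) \<le> K + 2 * real N * len x"
proof -
  define y where "y = x [^] N"
  have y: "y \<in> carrier G" using x by (simp add: y_def)
  have dec: "x [^] k = y [^] (k div N) \<otimes> x [^] (k mod N)" for k :: nat
    using x by (simp add: y_def nat_pow_pow nat_pow_mult)
  have rem: "len (x [^] (k mod N)) \<le> real N * len x" for k :: nat
  proof -
    have "len (x [^] (k mod N)) \<le> real (k mod N) * len x" by (rule len_pow_le[OF x])
    also have "\<dots> \<le> real N * len x" using N len_nonneg[OF x] by (intro mult_right_mono) (auto intro: less_imp_le)
    finally show ?thesis .
  qed
  have "inv (x [^] m) = inv (x [^] (m mod N) \<otimes> y [^] (m div N))"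
    using x by (simp add: y_def nat_pow_pow nat_pow_mult)
  then have im: "inv (x [^] m) = inv (y [^] (m div N)) \<otimes> inv (x [^] (m mod N))"
    using x y by (simp add: inv_mult_group)
  have "gp (inv (x [^] m)) (x [^] n) \<le> gp (inv (y [^] (m div N))) (x [^] n) + real N * len x"
    unfolding im using gp_perturb[of "inv (y [^] (m div N))" "inv (x [^] (m mod N))" "x [^] n"] x y rem[of m]
    by (simp add: len_inv)
  moreover have "gp (inv (y [^] (m div N))) (x [^] n) \<le> gp (inv (y [^] (m div N))) (y [^] (n div N)) + real N * len x"
    unfolding dec[of n]
    using gp_perturb[of "y [^] (n div N)" "x [^] (n mod N)" "inv (y [^] (m div N))"] x y rem[of n]
    by (simp add: gp_commute[of "inv (y [^] (m div N))"])
  moreover have "gp (inv (y [^] (m div N))) (y [^] (n div N)) \<le> K"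
    using ax unfolding y_def axial_def by blast
  ultimately show ?thesis by linarith
qed

text \<open>
  If squaring any power lengthens it by at most \<open>C\<close>, then halving the exponent repeatedly
  shows that the powers grow at most logarithmically.
\<close>

lemma log_growth:
  assumes x: "x \<in> carrier G" and C: "0 \<le> C"
    and dbl: "\<And>n::nat. 0 < n \<Longrightarrow> len (x [^] n \<otimes> x [^] n) \<le> len (x [^] n) + C"
    and m: "0 < m"
  shows "len (x [^] (m::nat)) \<le> (C + len x) * (log 2 (real m) + 1)"
  using m
proof (induction m rule: less_induct)
  case (less m)
  show ?case
  proof (cases "m = 1")
    case True
    then show ?thesis using x C by simp
  next
    case False
    define q where "q = m div 2"
    have q: "0 < q" "q < m" using less(2) False by (auto simp: q_def)
    have "x [^] m = (x [^] q \<otimes> x [^] q) \<otimes> x [^] (m mod 2)"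
      using x by (simp add: nat_pow_mult q_def flip: mult_2)
    then have "len (x [^] m) \<le> len (x [^] q) + C + len (x [^] (m mod 2))"
      using len_mult[of "x [^] q \<otimes> x [^] q" "x [^] (m mod 2)"] dbl[OF q(1)] x by simp
    moreover have "len (x [^] (m mod 2)) \<le> len x"
      using x len_nonneg[OF x] by (cases "even m") (simp_all add: len_one odd_iff_mod_2_eq_one)
    moreover have "len (x [^] q) \<le> (C + len x) * (log 2 (real q) + 1)" using less.IH q by blast
    moreover have "(C + len x) * (log 2 (real q) + 1) + (C + len x) \<le> (C + len x) * (log 2 (real m) + 1)"
    proof -
      have "log 2 (real q) + 1 = log 2 (2 * real q)" using q by (simp add: log_mult)
      also have "\<dots> \<le> log 2 (real m)" using q by (simp add: q_def)
      finally have "(C + len x) * (log 2 (real q) + 1 + 1) \<le> (C + len x) * (log 2 (real m) + 1)"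
        using C len_nonneg[OF x] by (intro mult_left_mono) auto
      then show ?thesis by (simp add: algebra_simps)
    qed
    ultimately show ?thesis by linarith
  qed
qed

text \<open>
  A dichotomy.  If some power of \<open>x\<close> has a long square, the powers of \<open>x\<close> run along a
  quasi-axis and \<open>m \<mapsto> f (x^m)\<close> is almost additive.  Otherwise the powers grow
  logarithmically and the limit is \<open>0\<close>.
\<close>

lemma stable_limit_exists:
  assumes f: "coarsely_additive f" and x: "x \<in> carrier G"
  shows "convergent (\<lambda>m::nat. f (x [^] m) / real m)"
proof (cases "\<exists>N::nat. 0 < N \<and> len (x [^] N) + 3 * \<delta> + 1 \<le> len (x [^] N \<otimes> x [^] N)")
  case True
  then obtain N K where N: "0 < N" "axial (x [^] (N::nat)) K"
    using axial_if_square_long x by blast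
  obtain c where c: "0 \<le> c" "\<And>x y. x \<in> carrier G \<Longrightarrow> y \<in> carrier G \<Longrightarrow> \<bar>f (x \<otimes> y) - f x - f y\<bar> \<le> c * (1 + gp (inv x) y)"
    using f unfolding coarsely_additive_def by blast
  have "\<bar>f (x [^] m \<otimes> x [^] n) - f (x [^] m) - f (x [^] n)\<bar> \<le> c * (1 + (K + 2 * real N * len x))" for m n :: nat
    using x axial_power_gp_bounded[OF N(2) x N(1), of m n] by (intro coarsely_additive_bound[OF c]) auto
  then show ?thesis
    using x by (intro convergent_if_almost_additive[where h = "\<lambda>m. f (x [^] m)"]) (simp add: nat_pow_mult)
next
  case False
  define C where "C = 3 * \<delta> + 1"
  have C: "0 \<le> C" using delta_nonneg by (simp add: C_def)
  have "len (x [^] n \<otimes> x [^] n) \<le> len (x [^] n) + C" if "0 < n" for n :: nat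
  proof (rule ccontr)
    assume "\<not> ?thesis"
    then have "len (x [^] n) + 3 * \<delta> + 1 \<le> len (x [^] n \<otimes> x [^] n)" unfolding C_def by linarith
    with False that show False by blast
  qed
  note log = log_growth[OF x C this]
  obtain E where E: "0 \<le> E" "\<And>x. x \<in> carrier G \<Longrightarrow> \<bar>f x\<bar> \<le> E * (len x + 2)"
    using coarsely_additive_linear_growth[OF f] by blast
  define D where "D = C + len x"
  have "\<bar>f (x [^] m) / real m\<bar> \<le> E * (D * (log 2 (real m) + 1) + 2) / real m" if "0 < m" for m :: nat
  proof -
    have "\<bar>f (x [^] m)\<bar> \<le> E * (len (x [^] m) + 2)" using E x by simp
    also have "\<dots> \<le> E * (D * (log 2 (real m) + 1) + 2)"
      using log[OF _ that] E(1) unfolding D_def by (intro mult_left_mono) auto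
    finally show ?thesis by (simp add: abs_divide divide_right_mono)
  qed
  then have "eventually (\<lambda>m. norm (f (x [^] m) / real m) \<le> E * (D * (log 2 (real m) + 1) + 2) / real m) sequentially"
    by (intro eventually_sequentiallyI[of 1]) auto
  moreover have "(\<lambda>m. E * (D * (log 2 (real m) + 1) + 2) / real m) \<longlonglongrightarrow> 0"
    by real_asymp
  ultimately have "(\<lambda>m. f (x [^] m) / real m) \<longlonglongrightarrow> 0"
    by (rule Lim_null_comparison)
  then show ?thesis by (rule convergentI)
qed

definition stable_limit :: "('a \<Rightarrow> real) \<Rightarrow> 'a \<Rightarrow> real" where
  "stable_limit f x = lim (\<lambda>m::nat. f (x [^] m) / real m)"

lemma stable_limit:
  assumes "coarsely_additive f" "x \<in> carrier G"
  shows "(\<lambda>m::nat. f (x [^] m) / real m) \<longlonglongrightarrow> stable_limit f x"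
  using stable_limit_exists[OF assms] by (simp add: convergent_LIMSEQ_iff stable_limit_def)

section \<open>Joining and closing\<close>

text \<open>
  The connector \<open>b\<close> depends on \<open>x\<close> and \<open>y\<close> only, so one map serves all coarsely additive
  functions and hence all coordinates of a tuple.
\<close>

lemma coarsely_additive_join:
  "\<exists>j. (\<forall>x\<in>carrier G. \<forall>y\<in>carrier G. j x y \<in> carrier G) \<and>
    (\<forall>f. coarsely_additive f \<longrightarrow>
      (\<exists>B. \<forall>x\<in>carrier G. \<forall>y\<in>carrier G. \<bar>f (j x y) - f x - f y\<bar> \<le> B))"
proof -
  obtain a R where conn: "\<And>x y. x \<in> carrier G \<Longrightarrow> y \<in> carrier G \<Longrightarrow> \<exists>b. b \<in> carrier G \<and>
     gp x b \<le> a \<and> gp (inv b) y \<le> a \<and> 2 * a + 2 * \<delta> < len b \<and> len b \<le> R"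
    using exists_connector by (metis (no_types, lifting))
  define b where "b x y = (SOME b. b \<in> carrier G \<and>
     gp (inv x) b \<le> a \<and> gp (inv b) y \<le> a \<and> 2 * a + 2 * \<delta> < len b \<and> len b \<le> R)" for x y
  have b: "b x y \<in> carrier G" "gp (inv x) (b x y) \<le> a" "gp (inv (b x y)) y \<le> a"
    "2 * a + 2 * \<delta> < len (b x y)" "len (b x y) \<le> R" if "x \<in> carrier G" "y \<in> carrier G" for x y
    using someI_ex[OF conn[of "inv x" y]] that unfolding b_def by auto
  show ?thesis
  proof (intro exI[of _ "\<lambda>x y. x \<otimes> b x y \<otimes> y"] conjI ballI allI impI)
    show "x \<otimes> b x y \<otimes> y \<in> carrier G" if "x \<in> carrier G" "y \<in> carrier G" for x y
      using b that by simp
    fix f assume "coarsely_additive f"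
    then obtain c where c: "0 \<le> c" "\<And>x y. x \<in> carrier G \<Longrightarrow> y \<in> carrier G \<Longrightarrow> \<bar>f (x \<otimes> y) - f x - f y\<bar> \<le> c * (1 + gp (inv x) y)"
      unfolding coarsely_additive_def by blast
    obtain M where M: "\<And>x. x \<in> carrier G \<Longrightarrow> len x \<le> R \<Longrightarrow> \<bar>f x\<bar> \<le> M"
      using bounded_on_balls[of R f] by blast
    show "\<exists>B. \<forall>x\<in>carrier G. \<forall>y\<in>carrier G. \<bar>f (x \<otimes> b x y \<otimes> y) - f x - f y\<bar> \<le> B"
    proof (intro exI[of _ "c * (1 + a) + c * (1 + (a + \<delta>)) + M"] ballI)
      fix x y assume xy: "x \<in> carrier G" "y \<in> carrier G"
      note b' = b[OF xy]
      have "\<bar>f (x \<otimes> b x y) - f x - f (b x y)\<bar> \<le> c * (1 + a)"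
        using b' xy by (intro coarsely_additive_bound[OF c])
      moreover have "gp (inv (x \<otimes> b x y)) y \<le> a + \<delta>"
        using b' xy delta_nonneg by (intro chain_step) auto
      then have "\<bar>f (x \<otimes> b x y \<otimes> y) - f (x \<otimes> b x y) - f y\<bar> \<le> c * (1 + (a + \<delta>))"
        using b' xy by (intro coarsely_additive_bound[OF c]) auto
      moreover have "\<bar>f (b x y)\<bar> \<le> M" using M b' by blast
      ultimately show "\<bar>f (x \<otimes> b x y \<otimes> y) - f x - f y\<bar> \<le> c * (1 + a) + c * (1 + (a + \<delta>)) + M"
        by linarith
    qed
  qed
qed

text \<open>
  With a connector \<open>b\<close> that suits \<open>x\<close> on both sides, the periodic product \<open>x b x b \<dots>\<close> has
  bounded cancellation at every joint as soon as \<open>x\<close> is long, so \<open>f ((x b)^m)\<close> is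
  \<open>m (f x + f b)\<close> up to an error linear in \<open>m\<close> with a uniform slope.  On the finitely
  many short \<open>x\<close> the function \<open>f\<close> is bounded, and \<open>\<one>\<close> serves as the value.
\<close>

lemma coarsely_additive_close:
  "\<exists>\<kappa>. (\<forall>x\<in>carrier G. \<kappa> x \<in> carrier G) \<and>
    (\<forall>f. coarsely_additive f \<longrightarrow> (\<exists>B. \<forall>x\<in>carrier G. \<bar>stable_limit f (\<kappa> x) - f x\<bar> \<le> B))"
proof -
  obtain a R where conn: "\<And>x y. x \<in> carrier G \<Longrightarrow> y \<in> carrier G \<Longrightarrow> \<exists>b. b \<in> carrier G \<and>
     gp x b \<le> a \<and> gp (inv b) y \<le> a \<and> 2 * a + 2 * \<delta> < len b \<and> len b \<le> R"
    using exists_connector by (metis (no_types, lifting))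
  define b where "b x = (SOME b. b \<in> carrier G \<and>
     gp (inv x) b \<le> a \<and> gp (inv b) x \<le> a \<and> 2 * a + 2 * \<delta> < len b \<and> len b \<le> R)" for x
  have b: "b x \<in> carrier G" "gp (inv x) (b x) \<le> a" "gp (inv (b x)) x \<le> a"
    "2 * a + 2 * \<delta> < len (b x)" "len (b x) \<le> R" if "x \<in> carrier G" for x
    using someI_ex[OF conn[of "inv x" x]] that unfolding b_def by auto
  have a0: "0 \<le> a" using b(2)[of \<one>] gp_nonneg[of "inv \<one>" "b \<one>"] b(1)[of \<one>] by simp
  define \<kappa> where "\<kappa> x = (if 2 * a + 2 * \<delta> < len x then x \<otimes> b x else \<one>)" for x
  show ?thesis
  proof (intro exI[of _ \<kappa>] conjI ballI allI impI)
    show "\<kappa> x \<in> carrier G" if "x \<in> carrier G" for x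
      using b that by (simp add: \<kappa>_def)
    fix f assume f: "coarsely_additive f"
    then obtain c where c: "0 \<le> c" "\<And>x y. x \<in> carrier G \<Longrightarrow> y \<in> carrier G \<Longrightarrow> \<bar>f (x \<otimes> y) - f x - f y\<bar> \<le> c * (1 + gp (inv x) y)"
      unfolding coarsely_additive_def by blast
    obtain M where M: "\<And>x. x \<in> carrier G \<Longrightarrow> len x \<le> R \<Longrightarrow> \<bar>f x\<bar> \<le> M"
      using bounded_on_balls[of R f] by blast
    obtain M' where M': "\<And>x. x \<in> carrier G \<Longrightarrow> len x \<le> 2 * a + 2 * \<delta> \<Longrightarrow> \<bar>f x\<bar> \<le> M'"
      using bounded_on_balls[of "2 * a + 2 * \<delta>" f] by blast
    define D where "D = c * (1 + (a + \<delta>))"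
    have D: "0 \<le> D" using c a0 delta_nonneg by (simp add: D_def)
    have f1: "\<bar>f \<one>\<bar> \<le> c" using c(2)[of \<one> \<one>] by (simp add: gp_one)
    show "\<exists>B. \<forall>x\<in>carrier G. \<bar>stable_limit f (\<kappa> x) - f x\<bar> \<le> B"
    proof (intro exI[of _ "max M' (2 * D + c + M)"] ballI)
      fix x assume x: "x \<in> carrier G"
      note b' = b[OF x]
      show "\<bar>stable_limit f (\<kappa> x) - f x\<bar> \<le> max M' (2 * D + c + M)"
      proof (cases "2 * a + 2 * \<delta> < len x")
        case True
        define y where "y = x \<otimes> b x"
        have y: "y \<in> carrier G" using x b' by (simp add: y_def)
        have chain: "gp (inv (y [^] m)) x \<le> a + \<delta> \<and> \<bar>f (y [^] m) - real m * (f x + f (b x))\<bar> \<le> real m * (2 * D) + c"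
          for m :: nat
        proof (induction m)
          case 0
          then show ?case using x a0 delta_nonneg f1 by (simp add: gp_one)
        next
          case (Suc m)
          have 1: "gp (inv (y [^] m \<otimes> x)) (b x) \<le> a + \<delta>"
            using Suc b' x y True by (intro chain_step) auto
          have 2: "gp (inv (y [^] m \<otimes> x \<otimes> b x)) x \<le> a + \<delta>"
            using x y by (intro chain_step[OF _ b'(1) x 1 b'(3,4)]) simp
          have e: "y [^] Suc m = y [^] m \<otimes> x \<otimes> b x"
            using x b' y by (simp add: y_def m_assoc)
          have "\<bar>f (y [^] m \<otimes> x) - f (y [^] m) - f x\<bar> \<le> D"
            unfolding D_def using Suc x y by (intro coarsely_additive_bound[OF c]) auto
          moreover have "\<bar>f (y [^] m \<otimes> x \<otimes> b x) - f (y [^] m \<otimes> x) - f (b x)\<bar> \<le> D"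
            unfolding D_def using 1 x y b' by (intro coarsely_additive_bound[OF c]) auto
          moreover have "real (Suc m) * (f x + f (b x)) = real m * (f x + f (b x)) + (f x + f (b x))"
            "real (Suc m) * (2 * D) = real m * (2 * D) + 2 * D" by (simp_all add: algebra_simps)
          ultimately show ?case using 2 Suc unfolding e by linarith
        qed
        have "\<bar>f (y [^] m) / real m - (f x + f (b x))\<bar> \<le> 2 * D + c" if "1 \<le> m" for m :: nat
        proof -
          have "f (y [^] m) / real m - (f x + f (b x)) = (f (y [^] m) - real m * (f x + f (b x))) / real m"
            using that by (simp add: field_simps)
          also have "\<bar>\<dots>\<bar> \<le> (real m * (2 * D) + c) / real m"
            using chain[of m] by (simp add: abs_divide divide_right_mono)
          also have "\<dots> \<le> (real m * (2 * D) + real m * c) / real m"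
            using that c(1) mult_right_mono[of 1 "real m" c] by (intro divide_right_mono) auto
          also have "\<dots> = 2 * D + c" using that by (simp add: field_simps)
          finally show ?thesis .
        qed
        moreover have "(\<lambda>m. \<bar>f (y [^] m) / real m - (f x + f (b x))\<bar>) \<longlonglongrightarrow> \<bar>stable_limit f y - (f x + f (b x))\<bar>"
          by (intro tendsto_intros stable_limit f y)
        ultimately have "\<bar>stable_limit f y - (f x + f (b x))\<bar> \<le> 2 * D + c"
          by (intro LIMSEQ_le_const2) auto
        moreover have "\<bar>f (b x)\<bar> \<le> M" using M b' by blast
        moreover have "\<kappa> x = y" using True by (simp add: \<kappa>_def y_def)
        ultimately show ?thesis by auto
      next
        case False
        have "(\<lambda>m. f \<one> / real m) \<longlonglongrightarrow> 0" by (rule lim_const_over_n)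
        moreover have "(\<lambda>m. f \<one> / real m) \<longlonglongrightarrow> stable_limit f \<one>"
          using stable_limit[OF f, of \<one>] by simp
        ultimately have "stable_limit f \<one> = 0" by (rule LIMSEQ_unique[symmetric])
        then show ?thesis using False M'[of x] x by (auto simp: \<kappa>_def)
      qed
    qed
  qed
qed

end

section \<open>Asymptotic cones\<close>

text \<open>
  The sequences in the definition amount to approximation by arbitrarily small multiples,
  a form that is stable under limits of \<open>v\<close>.
\<close>

lemma asymptotic_cone_iff:
  fixes T :: "'v::real_normed_vector set"
  shows "v \<in> asymptotic_cone T \<longleftrightarrow> (\<forall>e>0. \<exists>a t. 0 < a \<and> a < e \<and> t \<in> T \<and> dist (a *\<^sub>R t) v < e)"
proof
  assume "v \<in> asymptotic_cone T"
  then obtain \<alpha> :: "nat \<Rightarrow> real" and t where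
    at: "\<And>k. 0 < \<alpha> k" "\<alpha> \<longlonglongrightarrow> 0" "\<And>k. t k \<in> T" "(\<lambda>k. \<alpha> k *\<^sub>R t k) \<longlonglongrightarrow> v"
    unfolding asymptotic_cone_def by blast
  show "\<forall>e>0. \<exists>a t. 0 < a \<and> a < e \<and> t \<in> T \<and> dist (a *\<^sub>R t) v < e"
  proof (intro allI impI)
    fix e :: real assume "0 < e"
    then have "eventually (\<lambda>k. \<alpha> k < e) sequentially" "eventually (\<lambda>k. dist (\<alpha> k *\<^sub>R t k) v < e) sequentially"
      using order_tendstoD(2)[OF at(2)] tendstoD[OF at(4)] by blast+
    then have "eventually (\<lambda>k. \<alpha> k < e \<and> dist (\<alpha> k *\<^sub>R t k) v < e) sequentially"
      by (rule eventually_conj)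
    then obtain k where "\<alpha> k < e" "dist (\<alpha> k *\<^sub>R t k) v < e"
      by (auto simp: eventually_sequentially)
    then show "\<exists>a t. 0 < a \<and> a < e \<and> t \<in> T \<and> dist (a *\<^sub>R t) v < e" using at by blast
  qed
next
  assume *: "\<forall>e>0. \<exists>a t. 0 < a \<and> a < e \<and> t \<in> T \<and> dist (a *\<^sub>R t) v < e"
  then have "\<forall>k::nat. \<exists>r. 0 < fst r \<and> fst r < inverse (real (Suc k)) \<and> snd r \<in> T
      \<and> dist (fst r *\<^sub>R snd r) v < inverse (real (Suc k))"
    by (simp del: of_nat_Suc)
  from choice[OF this] obtain p where
    p: "\<And>k::nat. 0 < fst (p k) \<and> fst (p k) < inverse (real (Suc k)) \<and> snd (p k) \<in> T
      \<and> dist (fst (p k) *\<^sub>R snd (p k)) v < inverse (real (Suc k))" by blast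
  have "(\<lambda>k. fst (p k)) \<longlonglongrightarrow> 0"
    by (rule tendsto_sandwich[OF _ _ tendsto_const LIMSEQ_inverse_real_of_nat])
      (use p in \<open>auto intro!: always_eventually less_imp_le simp del: of_nat_Suc\<close>)
  moreover have "(\<lambda>k. dist (fst (p k) *\<^sub>R snd (p k)) v) \<longlonglongrightarrow> 0"
    by (rule tendsto_sandwich[OF _ _ tendsto_const LIMSEQ_inverse_real_of_nat])
      (use p in \<open>auto intro!: always_eventually less_imp_le simp del: of_nat_Suc\<close>)
  then have "(\<lambda>k. fst (p k) *\<^sub>R snd (p k)) \<longlonglongrightarrow> v" by (simp flip: tendsto_dist_iff)
  ultimately show "v \<in> asymptotic_cone T"
    unfolding asymptotic_cone_def using p
    by (intro CollectI exI[of _ "\<lambda>k. fst (p k)"] exI[of _ "\<lambda>k. snd (p k)"]) simp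
qed

lemma closed_asymptotic_cone: "closed (asymptotic_cone (T :: 'v::real_normed_vector set))"
proof -
  have "v \<in> asymptotic_cone T" if v: "v \<in> closure (asymptotic_cone T)" for v
    unfolding asymptotic_cone_iff
  proof (intro allI impI)
    fix e :: real assume e: "0 < e"
    then obtain w where w: "w \<in> asymptotic_cone T" "dist w v < e / 2"
      using v by (meson closure_approachable half_gt_zero)
    obtain a t where "0 < a" "a < e / 2" "t \<in> T" "dist (a *\<^sub>R t) w < e / 2"
      using w(1) e unfolding asymptotic_cone_iff by (meson half_gt_zero)
    moreover have "dist (a *\<^sub>R t) v \<le> dist (a *\<^sub>R t) w + dist w v" by (rule dist_triangle)
    ultimately show "\<exists>a t. 0 < a \<and> a < e \<and> t \<in> T \<and> dist (a *\<^sub>R t) v < e"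
      using w(2) by (intro exI[of _ a] exI[of _ t]) simp
  qed
  then show ?thesis using closure_subset_eq by blast
qed

text \<open>
  Powers with exponents close to \<open>t m\<close> realise the real multiple \<open>t L\<close> of a stable limit \<open>L\<close>.
\<close>

lemma tendsto_floor_subsequence:
  fixes h :: "nat \<Rightarrow> real"
  assumes h: "(\<lambda>m. h m / real m) \<longlonglongrightarrow> L" and t: "0 \<le> t"
  shows "(\<lambda>m. h (nat \<lfloor>t * real m\<rfloor>) / real m) \<longlonglongrightarrow> t * L"
proof (cases "t = 0")
  case True
  then show ?thesis by (simp add: lim_const_over_n)
next
  case False
  then have t: "0 < t" using t by simp
  define k where "k m = nat \<lfloor>t * real m\<rfloor>" for m :: nat
  have sub: "filterlim k sequentially sequentially"
    unfolding k_def using t by real_asymp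
  have "(\<lambda>m. real (k m) / real m) \<longlonglongrightarrow> t"
    unfolding k_def using t by real_asymp
  then have lim: "(\<lambda>m. real (k m) / real m * (h (k m) / real (k m))) \<longlonglongrightarrow> t * L"
    using filterlim_compose[OF h sub] by (rule tendsto_mult)
  have "eventually (\<lambda>m. 1 \<le> k m) sequentially"
    using sub by (simp add: filterlim_at_top)
  then have "eventually (\<lambda>m. real (k m) / real m * (h (k m) / real (k m)) = h (k m) / real m) sequentially"
    by eventually_elim simp
  from Lim_transform_eventually[OF lim this] show ?thesis by (simp only: k_def)
qed

section \<open>The cone of stable limits\<close>

context nonelementary_length_group begin

lemma coarsely_additive_linear_combination:
  fixes f :: "'n::finite \<Rightarrow> 'a \<Rightarrow> real"
  assumes f: "\<And>i. coarsely_additive (f i)"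
  shows "coarsely_additive (\<lambda>x. \<Sum>i\<in>UNIV. a i * f i x)"
proof -
  obtain c where c: "\<And>i. 0 \<le> c i"
    "\<And>i x y. x \<in> carrier G \<Longrightarrow> y \<in> carrier G \<Longrightarrow> \<bar>f i (x \<otimes> y) - f i x - f i y\<bar> \<le> c i * (1 + gp (inv x) y)"
    using f unfolding coarsely_additive_def by metis
  show ?thesis
    unfolding coarsely_additive_def
  proof (intro exI[of _ "\<Sum>i\<in>UNIV. \<bar>a i\<bar> * c i"] conjI ballI)
    show "0 \<le> (\<Sum>i\<in>UNIV. \<bar>a i\<bar> * c i)" using c by (intro sum_nonneg) simp
    fix x y assume xy: "x \<in> carrier G" "y \<in> carrier G"
    have "(\<Sum>i\<in>UNIV. a i * f i (x \<otimes> y)) - (\<Sum>i\<in>UNIV. a i * f i x) - (\<Sum>i\<in>UNIV. a i * f i y)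
        = (\<Sum>i\<in>UNIV. a i * (f i (x \<otimes> y) - f i x - f i y))"
      by (simp add: sum_subtractf right_diff_distrib)
    also have "\<bar>\<dots>\<bar> \<le> (\<Sum>i\<in>UNIV. \<bar>a i\<bar> * (c i * (1 + gp (inv x) y)))"
      using c(2)[OF xy] by (intro order_trans[OF sum_abs] sum_mono) (simp add: abs_mult mult_left_mono)
    also have "\<dots> = (\<Sum>i\<in>UNIV. \<bar>a i\<bar> * c i) * (1 + gp (inv x) y)"
      by (simp add: sum_distrib_right mult.assoc)
    finally show "\<bar>(\<Sum>i\<in>UNIV. a i * f i (x \<otimes> y)) - (\<Sum>i\<in>UNIV. a i * f i x) - (\<Sum>i\<in>UNIV. a i * f i y)\<bar>
        \<le> (\<Sum>i\<in>UNIV. \<bar>a i\<bar> * c i) * (1 + gp (inv x) y)" .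
  qed
qed

lemma stable_limit_linear_combination:
  fixes f :: "'n::finite \<Rightarrow> 'a \<Rightarrow> real"
  assumes f: "\<And>i. coarsely_additive (f i)" and x: "x \<in> carrier G"
  shows "stable_limit (\<lambda>x. \<Sum>i\<in>UNIV. a i * f i x) x = (\<Sum>i\<in>UNIV. a i * stable_limit (f i) x)"
proof -
  have "(\<lambda>m::nat. \<Sum>i\<in>UNIV. a i * (f i (x [^] m) / real m)) \<longlonglongrightarrow> (\<Sum>i\<in>UNIV. a i * stable_limit (f i) x)"
    by (intro tendsto_intros stable_limit f x)
  then have "(\<lambda>m::nat. (\<Sum>i\<in>UNIV. a i * f i (x [^] m)) / real m) \<longlonglongrightarrow> (\<Sum>i\<in>UNIV. a i * stable_limit (f i) x)"
    by (simp add: sum_divide_distrib)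
  then show ?thesis unfolding stable_limit_def by (rule limI)
qed

definition value_vector :: "('n::finite \<Rightarrow> 'a \<Rightarrow> real) \<Rightarrow> 'a \<Rightarrow> real ^ 'n" where
  "value_vector f x = (\<chi> i. f i x)"

definition stable_vector :: "('n::finite \<Rightarrow> 'a \<Rightarrow> real) \<Rightarrow> 'a \<Rightarrow> real ^ 'n" where
  "stable_vector f x = (\<chi> i. stable_limit (f i) x)"

definition stable_rays :: "('n::finite \<Rightarrow> 'a \<Rightarrow> real) \<Rightarrow> (real ^ 'n) set" where
  "stable_rays f = {t *\<^sub>R stable_vector f x | t x. 0 \<le> t \<and> x \<in> carrier G}"

lemma norm_bounded_if_components_bounded:
  fixes V :: "'c \<Rightarrow> real ^ 'n"
  assumes "\<And>i. \<exists>B. \<forall>p\<in>P. \<bar>V p $ i\<bar> \<le> B"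
  shows "\<exists>B. \<forall>p\<in>P. norm (V p) \<le> B"
proof -
  obtain B where B: "\<And>i. \<forall>p\<in>P. \<bar>V p $ i\<bar> \<le> B i" using assms by metis
  have "norm (V p) \<le> (\<Sum>i\<in>UNIV. B i)" if "p \<in> P" for p
    using B that by (intro order_trans[OF norm_le_l1_cart] sum_mono) blast
  then show ?thesis by blast
qed

text \<open>
  Joining the powers of \<open>x\<close> and \<open>y\<close> with exponents about \<open>t m\<close> and \<open>s m\<close> and dividing by \<open>m\<close>
  gives \<open>t \<Lambda>(x) + s \<Lambda>(y)\<close> in the limit.
\<close>

lemma stable_rays_sum_in_asymptotic_cone:
  assumes f: "\<And>i. coarsely_additive (f i)"
    and u: "u \<in> stable_rays f" and v: "v \<in> stable_rays f"
  shows "u + v \<in> asymptotic_cone (value_vector f ` carrier G)"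
proof -
  obtain t x s y where tx: "0 \<le> t" "x \<in> carrier G" "u = t *\<^sub>R stable_vector f x"
    and sy: "0 \<le> s" "y \<in> carrier G" "v = s *\<^sub>R stable_vector f y"
    using u v unfolding stable_rays_def by blast
  obtain j where j: "\<And>x y. x \<in> carrier G \<Longrightarrow> y \<in> carrier G \<Longrightarrow> j x y \<in> carrier G"
    "\<And>f. coarsely_additive f \<Longrightarrow> \<exists>B. \<forall>x\<in>carrier G. \<forall>y\<in>carrier G. \<bar>f (j x y) - f x - f y\<bar> \<le> B"
    using coarsely_additive_join by metis
  define p where "p m = x [^] nat \<lfloor>t * real m\<rfloor>" for m :: nat
  define q where "q m = y [^] nat \<lfloor>s * real m\<rfloor>" for m :: nat
  have pq: "p m \<in> carrier G" "q m \<in> carrier G" for m using tx sy by (simp_all add: p_def q_def)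
  have comp: "(\<lambda>m. f i (j (p m) (q m)) / real m) \<longlonglongrightarrow> t * stable_limit (f i) x + s * stable_limit (f i) y" for i
  proof -
    obtain B where B: "\<forall>x\<in>carrier G. \<forall>y\<in>carrier G. \<bar>f i (j x y) - f i x - f i y\<bar> \<le> B"
      using j(2)[OF f] by blast
    have "(\<lambda>m. f i (p m) / real m + f i (q m) / real m) \<longlonglongrightarrow> t * stable_limit (f i) x + s * stable_limit (f i) y"
      unfolding p_def q_def using tx sy
      by (intro tendsto_add tendsto_floor_subsequence[where h = "\<lambda>m. f i (x [^] m)"]
          tendsto_floor_subsequence[where h = "\<lambda>m. f i (y [^] m)"] stable_limit f) auto
    moreover have "(\<lambda>m. (f i (j (p m) (q m)) - f i (p m) - f i (q m)) / real m) \<longlonglongrightarrow> 0"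
    proof (rule Lim_null_comparison)
      show "eventually (\<lambda>m. norm ((f i (j (p m) (q m)) - f i (p m) - f i (q m)) / real m) \<le> B / real m) sequentially"
        using B pq by (intro always_eventually allI) (simp add: abs_divide divide_right_mono)
      show "(\<lambda>m. B / real m) \<longlonglongrightarrow> 0" by (rule lim_const_over_n)
    qed
    ultimately have "(\<lambda>m. f i (p m) / real m + f i (q m) / real m
        + (f i (j (p m) (q m)) - f i (p m) - f i (q m)) / real m)
        \<longlonglongrightarrow> t * stable_limit (f i) x + s * stable_limit (f i) y + 0"
      by (rule tendsto_add)
    then show ?thesis by (simp add: diff_divide_distrib)
  qed
  have "(\<lambda>m. inverse (real m) *\<^sub>R value_vector f (j (p m) (q m))) \<longlonglongrightarrow> u + v"
  proof (rule vec_tendstoI)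
    show "(\<lambda>m. (inverse (real m) *\<^sub>R value_vector f (j (p m) (q m))) $ i) \<longlonglongrightarrow> (u + v) $ i" for i
      using comp[of i] tx sy by (simp add: value_vector_def stable_vector_def divide_inverse mult.commute)
  qed
  then have "(\<lambda>m. inverse (real (Suc m)) *\<^sub>R value_vector f (j (p (Suc m)) (q (Suc m)))) \<longlonglongrightarrow> u + v"
    by (rule LIMSEQ_Suc)
  then show ?thesis
    unfolding asymptotic_cone_def using LIMSEQ_inverse_real_of_nat j(1) pq
    by (intro CollectI exI[of _ "\<lambda>m. inverse (real (Suc m))"]
        exI[of _ "\<lambda>m. value_vector f (j (p (Suc m)) (q (Suc m)))"]) (auto simp del: of_nat_Suc)
qed

lemma zero_in_stable_rays: "0 \<in> stable_rays f"
  unfolding stable_rays_def by (intro CollectI exI[of _ "0::real"] exI[of _ \<one>]) simp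

text \<open>
  A ray is the sum of itself and \<open>0\<close>, which gives one inclusion.  For the other, replacing
  \<open>x\<close> by \<open>\<kappa> x\<close> changes the vector by a bounded amount, which vanishes after rescaling.
\<close>

lemma closure_stable_rays_eq_asymptotic_cone:
  assumes f: "\<And>i. coarsely_additive (f i)"
  shows "closure (stable_rays f) = asymptotic_cone (value_vector f ` carrier G)"
proof
  show "closure (stable_rays f) \<subseteq> asymptotic_cone (value_vector f ` carrier G)"
  proof (rule closure_minimal[OF _ closed_asymptotic_cone], rule subsetI)
    fix u assume "u \<in> stable_rays f"
    from stable_rays_sum_in_asymptotic_cone[OF f this zero_in_stable_rays]
    show "u \<in> asymptotic_cone (value_vector f ` carrier G)" by simp
  qed
  show "asymptotic_cone (value_vector f ` carrier G) \<subseteq> closure (stable_rays f)"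
  proof
    fix v assume "v \<in> asymptotic_cone (value_vector f ` carrier G)"
    then obtain \<alpha> :: "nat \<Rightarrow> real" and t where
      at: "\<And>k. 0 < \<alpha> k" "\<alpha> \<longlonglongrightarrow> 0" "\<forall>k. t k \<in> value_vector f ` carrier G" "(\<lambda>k. \<alpha> k *\<^sub>R t k) \<longlonglongrightarrow> v"
      unfolding asymptotic_cone_def by blast
    have "\<forall>k. \<exists>y. y \<in> carrier G \<and> t k = value_vector f y" using at(3) by blast
    from choice[OF this] obtain x where x: "\<And>k. x k \<in> carrier G" "\<And>k. t k = value_vector f (x k)" by blast
    obtain \<kappa> where \<kappa>: "\<And>x. x \<in> carrier G \<Longrightarrow> \<kappa> x \<in> carrier G"
      "\<And>f. coarsely_additive f \<Longrightarrow> \<exists>B. \<forall>x\<in>carrier G. \<bar>stable_limit f (\<kappa> x) - f x\<bar> \<le> B"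
      using coarsely_additive_close by metis
    have "\<exists>B. \<forall>x\<in>carrier G. norm (stable_vector f (\<kappa> x) - value_vector f x) \<le> B"
      using \<kappa>(2)[OF f] by (intro norm_bounded_if_components_bounded) (simp add: stable_vector_def value_vector_def)
    then obtain B where B: "\<And>x. x \<in> carrier G \<Longrightarrow> norm (stable_vector f (\<kappa> x) - value_vector f x) \<le> B"
      by blast
    have "(\<lambda>k. \<alpha> k *\<^sub>R (stable_vector f (\<kappa> (x k)) - value_vector f (x k))) \<longlonglongrightarrow> 0"
    proof (rule Lim_null_comparison)
      show "eventually (\<lambda>k. norm (\<alpha> k *\<^sub>R (stable_vector f (\<kappa> (x k)) - value_vector f (x k))) \<le> \<alpha> k * B) sequentially"
        using at(1) B x by (intro always_eventually allI) (simp add: mult_left_mono less_imp_le)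
      show "(\<lambda>k. \<alpha> k * B) \<longlonglongrightarrow> 0" using tendsto_mult_right[OF at(2), of B] by simp
    qed
    from tendsto_add[OF this at(4)]
    have "(\<lambda>k. \<alpha> k *\<^sub>R stable_vector f (\<kappa> (x k))) \<longlonglongrightarrow> v"
      by (simp add: x(2) scaleR_diff_right)
    moreover have "\<alpha> k *\<^sub>R stable_vector f (\<kappa> (x k)) \<in> stable_rays f" for k
      unfolding stable_rays_def using \<kappa>(1) x(1) at(1) less_imp_le by blast
    ultimately show "v \<in> closure (stable_rays f)"
      unfolding closure_sequential
      by (intro exI[of _ "\<lambda>k. \<alpha> k *\<^sub>R stable_vector f (\<kappa> (x k))"]) simp
  qed
qed

lemma stable_rays_scale:
  assumes "u \<in> stable_rays f" "0 \<le> a" shows "a *\<^sub>R u \<in> stable_rays f"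
proof -
  obtain t x where "0 \<le> t" "x \<in> carrier G" "u = t *\<^sub>R stable_vector f x"
    using assms unfolding stable_rays_def by blast
  then show ?thesis
    unfolding stable_rays_def using assms(2) by (intro CollectI exI[of _ "a * t"] exI[of _ x]) simp
qed

lemma convex_closure_stable_rays:
  assumes f: "\<And>i. coarsely_additive (f i)"
  shows "convex (closure (stable_rays f))"
proof (rule convexI)
  fix u v :: "real ^ 'c" and a b :: real
  assume "u \<in> closure (stable_rays f)" "v \<in> closure (stable_rays f)" and ab: "0 \<le> a" "0 \<le> b"
  then obtain U V where U: "\<And>k. U k \<in> stable_rays f" "U \<longlonglongrightarrow> u" and V: "\<And>k. V k \<in> stable_rays f" "V \<longlonglongrightarrow> v"
    unfolding closure_sequential by blast
  have "a *\<^sub>R U k + b *\<^sub>R V k \<in> closure (stable_rays f)" for k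
    unfolding closure_stable_rays_eq_asymptotic_cone[OF f]
    by (intro stable_rays_sum_in_asymptotic_cone f stable_rays_scale U V ab)
  moreover have "(\<lambda>k. a *\<^sub>R U k + b *\<^sub>R V k) \<longlonglongrightarrow> a *\<^sub>R u + b *\<^sub>R v"
    by (intro tendsto_intros U V)
  ultimately show "a *\<^sub>R u + b *\<^sub>R v \<in> closure (stable_rays f)"
    by (rule closed_sequentially[OF closed_closure])
qed

text \<open>
  The closing map turns \<open>f x\<close> into a stable limit up to a bounded error, so the stable limits
  see every unbounded function.
\<close>

lemma stable_limit_zero_iff_bounded:
  assumes f: "coarsely_additive f"
  shows "(\<forall>x\<in>carrier G. stable_limit f x = 0) \<longleftrightarrow> (\<exists>B. \<forall>x\<in>carrier G. \<bar>f x\<bar> \<le> B)"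
proof
  assume zero: "\<forall>x\<in>carrier G. stable_limit f x = 0"
  obtain \<kappa> where "\<And>x. x \<in> carrier G \<Longrightarrow> \<kappa> x \<in> carrier G"
    "\<exists>B. \<forall>x\<in>carrier G. \<bar>stable_limit f (\<kappa> x) - f x\<bar> \<le> B"
    using coarsely_additive_close f by metis
  then show "\<exists>B. \<forall>x\<in>carrier G. \<bar>f x\<bar> \<le> B" using zero by simp
next
  assume "\<exists>B. \<forall>x\<in>carrier G. \<bar>f x\<bar> \<le> B"
  then obtain B where B: "\<And>x. x \<in> carrier G \<Longrightarrow> \<bar>f x\<bar> \<le> B" by blast
  show "\<forall>x\<in>carrier G. stable_limit f x = 0"
  proof
    fix x assume x: "x \<in> carrier G"
    have "(\<lambda>m::nat. f (x [^] m) / real m) \<longlonglongrightarrow> 0"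
    proof (rule Lim_null_comparison)
      show "eventually (\<lambda>m. norm (f (x [^] m) / real m) \<le> B / real m) sequentially"
        using B x by (intro always_eventually allI) (simp add: abs_divide divide_right_mono)
      show "(\<lambda>m. B / real m) \<longlonglongrightarrow> 0" by (rule lim_const_over_n)
    qed
    then show "stable_limit f x = 0" unfolding stable_limit_def by (rule limI)
  qed
qed

text \<open>
  A convex set has empty interior only if it lies in a hyperplane, which passes through \<open>0\<close>
  here.  A normal vector of that hyperplane is the same as a linear combination with vanishing
  stable limits, that is, a bounded one.
\<close>

lemma interior_stable_rays_iff:
  fixes f :: "'n::finite \<Rightarrow> 'a \<Rightarrow> real"
  assumes f: "\<And>i. coarsely_additive (f i)"
  shows "interior (closure (stable_rays f)) \<noteq> {} \<longleftrightarrow>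
    (\<forall>c. (\<exists>B. \<forall>x\<in>carrier G. \<bar>\<Sum>i\<in>UNIV. c i * f i x\<bar> \<le> B) \<longrightarrow> (\<forall>i. c i = 0))"
proof -
  let ?K = "closure (stable_rays f)"
  have normal: "(\<exists>B. \<forall>x\<in>carrier G. \<bar>\<Sum>i\<in>UNIV. c $ i * f i x\<bar> \<le> B) \<longleftrightarrow> ?K \<subseteq> {v. c \<bullet> v = 0}" for c :: "real ^ 'n"
  proof -
    have lin: "stable_limit (\<lambda>x. \<Sum>i\<in>UNIV. c $ i * f i x) x = c \<bullet> stable_vector f x" if "x \<in> carrier G" for x
      using stable_limit_linear_combination[where f = f, OF f that, of "\<lambda>i. c $ i"]
      by (simp add: inner_vec_def stable_vector_def)
    have "(\<exists>B. \<forall>x\<in>carrier G. \<bar>\<Sum>i\<in>UNIV. c $ i * f i x\<bar> \<le> B)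
        \<longleftrightarrow> (\<forall>x\<in>carrier G. stable_limit (\<lambda>x. \<Sum>i\<in>UNIV. c $ i * f i x) x = 0)"
      by (rule stable_limit_zero_iff_bounded[symmetric, OF coarsely_additive_linear_combination[OF f]])
    also have "\<dots> \<longleftrightarrow> (\<forall>x\<in>carrier G. c \<bullet> stable_vector f x = 0)"
      using lin by simp
    also have "\<dots> \<longleftrightarrow> stable_rays f \<subseteq> {v. c \<bullet> v = 0}"
    proof
      assume "stable_rays f \<subseteq> {v. c \<bullet> v = 0}"
      moreover have "1 *\<^sub>R stable_vector f x \<in> stable_rays f" if "x \<in> carrier G" for x
        unfolding stable_rays_def using that zero_le_one by blast
      ultimately show "\<forall>x\<in>carrier G. c \<bullet> stable_vector f x = 0" by auto
    qed (auto simp: stable_rays_def)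
    also have "\<dots> \<longleftrightarrow> ?K \<subseteq> {v. c \<bullet> v = 0}"
      using closure_minimal[OF _ closed_hyperplane] closure_subset by blast
    finally show ?thesis .
  qed
  show ?thesis
  proof (intro iffI allI impI)
    fix c and i
    assume int: "interior ?K \<noteq> {}" and B: "\<exists>B. \<forall>x\<in>carrier G. \<bar>\<Sum>i\<in>UNIV. c i * f i x\<bar> \<le> B"
    have "interior ?K \<subseteq> interior {v. (\<chi> i. c i) \<bullet> v = 0}"
      using normal[of "\<chi> i. c i"] B by (intro interior_mono) simp
    then have "(\<chi> i. c i) = 0" using int interior_hyperplane by fastforce
    then show "c i = 0" by (simp add: vec_eq_iff)
  next
    assume indep: "\<forall>c. (\<exists>B. \<forall>x\<in>carrier G. \<bar>\<Sum>i\<in>UNIV. c i * f i x\<bar> \<le> B) \<longrightarrow> (\<forall>i. c i = 0)"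
    show "interior ?K \<noteq> {}"
    proof
      assume "interior ?K = {}"
      then obtain c b where c: "c \<noteq> 0" "?K \<subseteq> {v. c \<bullet> v = b}"
        by (rule empty_interior_subset_hyperplane[OF convex_closure_stable_rays[OF f]])
      have "0 \<in> ?K" using zero_in_stable_rays closure_subset by blast
      with c(2) have "c \<bullet> 0 = b" by blast
      then have "?K \<subseteq> {v. c \<bullet> v = 0}" using c(2) by simp
      then have "\<forall>i. c $ i = 0" using normal[of c] indep by blast
      then show False using c(1) by (simp add: vec_eq_iff)
    qed
  qed
qed

end

section \<open>Word lengths\<close>

definition word_value :: "('a, 'b) monoid_scheme \<Rightarrow> 'a list \<Rightarrow> 'a" where
  "word_value G ws = foldr (\<otimes>\<^bsub>G\<^esub>) ws \<one>\<^bsub>G\<^esub>"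

context group begin

lemma word_value_closed: "set ws \<subseteq> carrier G \<Longrightarrow> word_value G ws \<in> carrier G"
  by (induction ws) (auto simp: word_value_def)

lemma word_value_append:
  "set us \<subseteq> carrier G \<Longrightarrow> set ws \<subseteq> carrier G
    \<Longrightarrow> word_value G (us @ ws) = word_value G us \<otimes> word_value G ws"
proof (induction us)
  case Nil
  then show ?case using word_value_closed[of ws] by (simp add: word_value_def)
next
  case (Cons a us)
  then show ?case
    using word_value_closed[of us] word_value_closed[of ws] by (simp add: word_value_def m_assoc)
qed

lemma word_value_inverse:
  assumes "set ws \<subseteq> carrier G"
  shows "word_value G (rev (map (m_inv G) ws)) = inv (word_value G ws)"
  using assms
proof (induction ws)
  case Nil
  then show ?case by (simp add: word_value_def)
next
  case (Cons a ws)
  have "word_value G (rev (map (m_inv G) (a # ws))) = inv (word_value G ws) \<otimes> word_value G [inv a]"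
    using Cons word_value_append[of "rev (map (m_inv G) ws)" "[inv a]"] by (auto simp: subset_iff)
  also have "\<dots> = inv (word_value G (a # ws))"
    using Cons word_value_closed[of ws] by (simp add: word_value_def inv_mult_group)
  finally show ?case .
qed

context
  fixes S assumes S: "finite_symmetric_generating_set G S"
begin

lemma generators_in_carrier: "S \<subseteq> carrier G"
  using S by (simp add: finite_symmetric_generating_set_def)

lemma word_exists:
  assumes "x \<in> carrier G" shows "\<exists>ws. set ws \<subseteq> S \<and> word_value G ws = x"
proof -
  have "x \<in> generate G S" using S assms by (simp add: finite_symmetric_generating_set_def)
  then show ?thesis
  proof (induction rule: generate.induct)
    case one
    then show ?case by (intro exI[of _ "[]"]) (simp add: word_value_def)
  next
    case (incl h)
    then show ?case using generators_in_carrier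
      by (intro exI[of _ "[h]"]) (auto simp: word_value_def)
  next
    case (inv h)
    then have "inv h \<in> S" using S by (simp add: finite_symmetric_generating_set_def)
    then show ?case using generators_in_carrier
      by (intro exI[of _ "[inv h]"]) (auto simp: word_value_def)
  next
    case (eng h1 h2)
    then obtain us ws where "set us \<subseteq> S" "word_value G us = h1" "set ws \<subseteq> S" "word_value G ws = h2"
      by blast
    then show ?case using word_value_append[of us ws] generators_in_carrier
      by (intro exI[of _ "us @ ws"]) auto
  qed
qed

lemma word_length_le: "set ws \<subseteq> S \<Longrightarrow> word_length G S (word_value G ws) \<le> length ws"
  unfolding word_length_def word_value_def by (rule Least_le) blast

lemma geodesic_word_exists:
  assumes "x \<in> carrier G"
  shows "\<exists>ws. length ws = word_length G S x \<and> set ws \<subseteq> S \<and> word_value G ws = x"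
proof -
  have "\<exists>n ws. length ws = n \<and> set ws \<subseteq> S \<and> foldr (\<otimes>) ws \<one> = x"
    using word_exists[OF assms] unfolding word_value_def by blast
  from LeastI_ex[OF this] show ?thesis unfolding word_length_def word_value_def .
qed

lemma word_length_one: "word_length G S \<one> = 0"
  using word_length_le[of "[]"] by (simp add: word_value_def)

lemma word_length_mult:
  assumes "x \<in> carrier G" "y \<in> carrier G"
  shows "word_length G S (x \<otimes> y) \<le> word_length G S x + word_length G S y"
proof -
  obtain us ws where "length us = word_length G S x" "set us \<subseteq> S" "word_value G us = x"
    "length ws = word_length G S y" "set ws \<subseteq> S" "word_value G ws = y"
    using geodesic_word_exists assms by metis
  then show ?thesis
    using word_length_le[of "us @ ws"] word_value_append[of us ws] generators_in_carrier by auto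
qed

lemma word_length_inv_le:
  assumes "x \<in> carrier G" shows "word_length G S (inv x) \<le> word_length G S x"
proof -
  obtain ws where ws: "length ws = word_length G S x" "set ws \<subseteq> S" "word_value G ws = x"
    using geodesic_word_exists assms by blast
  then have "set (rev (map (m_inv G) ws)) \<subseteq> S"
    using S by (auto simp: finite_symmetric_generating_set_def)
  moreover have "word_value G (rev (map (m_inv G) ws)) = inv x"
    using word_value_inverse[of ws] ws generators_in_carrier by auto
  ultimately show ?thesis using word_length_le[of "rev (map (m_inv G) ws)"] ws by simp
qed

lemma word_length_inv: "x \<in> carrier G \<Longrightarrow> word_length G S (inv x) = word_length G S x"
  using word_length_inv_le[of x] word_length_inv_le[of "inv x"] by simp

lemma finite_word_ball: "finite {x \<in> carrier G. real (word_length G S x) \<le> r}"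
proof (rule finite_subset)
  show "{x \<in> carrier G. real (word_length G S x) \<le> r}
      \<subseteq> word_value G ` {ws. set ws \<subseteq> S \<and> length ws \<le> nat \<lfloor>r\<rfloor>}"
  proof
    fix x assume "x \<in> {x \<in> carrier G. real (word_length G S x) \<le> r}"
    then have x: "x \<in> carrier G" "word_length G S x \<le> nat \<lfloor>r\<rfloor>" by (auto intro: le_nat_floor)
    obtain ws where "length ws = word_length G S x" "set ws \<subseteq> S" "word_value G ws = x"
      using geodesic_word_exists x by blast
    then show "x \<in> word_value G ` {ws. set ws \<subseteq> S \<and> length ws \<le> nat \<lfloor>r\<rfloor>}"
      using x by auto
  qed
  show "finite (word_value G ` {ws. set ws \<subseteq> S \<and> length ws \<le> nat \<lfloor>r\<rfloor>})"
    using S by (intro finite_imageI finite_lists_length_le) (simp add: finite_symmetric_generating_set_def)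
qed

lemma word_length_split:
  assumes x: "x \<in> carrier G" and k: "k \<le> word_length G S x"
  shows "\<exists>y\<in>carrier G. \<exists>z\<in>carrier G. x = y \<otimes> z \<and> word_length G S y = k
     \<and> word_length G S z = word_length G S x - k"
proof -
  obtain ws where ws: "length ws = word_length G S x" "set ws \<subseteq> S" "word_value G ws = x"
    using geodesic_word_exists x by blast
  have sub: "set (take k ws) \<subseteq> S" "set (drop k ws) \<subseteq> S"
    using ws(2) set_take_subset[of k ws] set_drop_subset[of k ws] by (auto dest: subsetD)
  then have car: "set (take k ws) \<subseteq> carrier G" "set (drop k ws) \<subseteq> carrier G"
    using generators_in_carrier by (auto dest: subsetD)
  define y where "y = word_value G (take k ws)"
  define z where "z = word_value G (drop k ws)"
  have yz: "y \<in> carrier G" "z \<in> carrier G" "x = y \<otimes> z"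
    using word_value_closed[OF car(1)] word_value_closed[OF car(2)] word_value_append[OF car] ws(3)
    by (simp_all add: y_def z_def)
  have "word_length G S y \<le> k" "word_length G S z \<le> word_length G S x - k"
    using word_length_le[OF sub(1)] word_length_le[OF sub(2)] ws(1) k by (simp_all add: y_def z_def)
  moreover have "word_length G S x \<le> word_length G S y + word_length G S z"
    using word_length_mult[OF yz(1,2)] yz(3) by simp
  ultimately show ?thesis using k yz by (intro bexI[of _ y] bexI[of _ z] conjI) auto
qed

lemma left_invariant_word_metric: "left_invariant G (word_metric G S)"
  unfolding left_invariant_def word_metric_def
proof (intro ballI)
  fix s x y assume "s \<in> carrier G" "x \<in> carrier G" "y \<in> carrier G"
  then have "inv (s \<otimes> x) \<otimes> (s \<otimes> y) = inv x \<otimes> (inv s \<otimes> s \<otimes> y)"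
    by (simp only: inv_mult_group m_assoc inv_closed m_closed)
  then show "real (word_length G S (inv (s \<otimes> x) \<otimes> (s \<otimes> y))) = real (word_length G S (inv x \<otimes> y))"
    using \<open>s \<in> carrier G\<close> \<open>y \<in> carrier G\<close> by simp
qed

lemma pseudo_metric_word_metric: "pseudo_metric_on (carrier G) (word_metric G S)"
  unfolding pseudo_metric_on_def
proof (intro conjI ballI)
  fix x y z assume xyz: "x \<in> carrier G" "y \<in> carrier G" "z \<in> carrier G"
  have "inv x \<otimes> z = (inv x \<otimes> y) \<otimes> (inv y \<otimes> z)"
    using xyz inv_solve_left[of "inv y \<otimes> z" y z] by (simp add: m_assoc)
  then show "word_metric G S x z \<le> word_metric G S x y + word_metric G S y z"
    using word_length_mult[of "inv x \<otimes> y" "inv y \<otimes> z"] xyz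
    by (simp add: word_metric_def flip: of_nat_add)
next
  fix x y assume "x \<in> carrier G" "y \<in> carrier G"
  then show "word_metric G S x y = word_metric G S y x"
    using word_length_inv[of "inv x \<otimes> y"] by (simp add: word_metric_def inv_mult_group)
qed (simp_all add: word_metric_def word_length_one)

lemma word_metric_in_hyperbolic_pseudo_metrics:
  assumes "gromov_hyperbolic_on (carrier G) (word_metric G S)"
  shows "word_metric G S \<in> hyperbolic_pseudo_metrics G"
proof -
  have "quasi_isometric_on (carrier G) (word_metric G S) (word_metric G S)"
    unfolding quasi_isometric_on_def by (intro exI[of _ 1] exI[of _ 0] conjI) auto
  then show ?thesis
    unfolding hyperbolic_pseudo_metrics_def
    using assms S pseudo_metric_word_metric left_invariant_word_metric by blast
qed

lemma gromov_product_word_metric: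
  assumes "x \<in> carrier G" "y \<in> carrier G"
  shows "gromov_product (word_metric G S) \<one> x y = length_product G (\<lambda>x. real (word_length G S x)) x y"
  using assms by (simp add: gromov_product_def length_product_def word_metric_def word_length_inv)

end

lemma gromov_product_left_invariant:
  assumes "left_invariant G \<psi>" "x \<in> carrier G" "y \<in> carrier G"
  shows "gromov_product \<psi> \<one> (inv x) y = (\<psi> \<one> x + \<psi> \<one> y - \<psi> \<one> (x \<otimes> y)) / 2"
proof -
  have "\<psi> (x \<otimes> inv x) (x \<otimes> \<one>) = \<psi> (inv x) \<one>" "\<psi> (x \<otimes> inv x) (x \<otimes> y) = \<psi> (inv x) y"
    using assms unfolding left_invariant_def by blast+
  then show ?thesis using assms by (simp add: gromov_product_def)
qed

text \<open>
  Every right coset of \<open>\<langle>g\<rangle>\<close> meets the finite set \<open>F\<close>, so the index is finite.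
\<close>

lemma virtually_cyclic_if_near_cyclic_subgroup:
  assumes g: "g \<in> carrier G" and F: "finite F"
    and near: "\<And>x. x \<in> carrier G \<Longrightarrow> \<exists>m::int. g [^] m \<otimes> x \<in> F"
  shows "virtually_cyclic G"
proof -
  define H where "H = generate G {g}"
  have H: "H = range (\<lambda>m::int. g [^] m)" using generate_pow[OF g] by (auto simp: H_def)
  have sub: "subgroup H G" unfolding H_def using g by (intro generate_is_subgroup) simp
  then interpret HG: group "G\<lparr>carrier := H\<rparr>" by (rule subgroup_imp_group)
  have gH: "g \<in> H" unfolding H_def by (simp add: generate.incl)
  have "H = range (\<lambda>m::int. g [^]\<^bsub>G\<lparr>carrier := H\<rparr>\<^esub> m)"
    using H int_pow_consistent[OF sub gH] by simp
  then have "cyclic_group (G\<lparr>carrier := H\<rparr>)"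
    unfolding HG.cyclic_group using gH by auto
  moreover have "rcosets H \<subseteq> (\<lambda>u. H #> u) ` F"
  proof
    fix C assume "C \<in> rcosets H"
    then obtain x where x: "x \<in> carrier G" "C = H #> x" unfolding RCOSETS_def by blast
    obtain m :: int where m: "g [^] m \<otimes> x \<in> F" using near x(1) by blast
    have "g [^] m \<otimes> x \<in> H #> x" unfolding r_coset_def H by blast
    from repr_independence[OF this x(1) sub] show "C \<in> (\<lambda>u. H #> u) ` F" using m x(2) by blast
  qed
  then have "finite (rcosets H)" using F finite_surj by blast
  ultimately show ?thesis unfolding virtually_cyclic_def using sub by blast
qed

end

section \<open>The translation cone\<close>

theorem theorem1p3:
  fixes G :: "('a, 'b) monoid_scheme"
    and \<psi> :: "'n::finite \<Rightarrow> 'a \<Rightarrow> 'a \<Rightarrow> real"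
  assumes "nonelementary_hyperbolic_group G"
    and "\<And>i. \<psi> i \<in> hyperbolic_metric_potentials G"
  shows "convex (translation_cone G \<psi>)
       \<and> translation_cone G \<psi> = asymptotic_cone (potential_vector G \<psi> ` carrier G)
       \<and> (interior (translation_cone G \<psi>) \<noteq> {} \<longleftrightarrow> independent_potentials G \<psi>)"
proof -
  interpret group G using assms(1) by (simp add: nonelementary_hyperbolic_group_def)
  obtain S where S: "finite_symmetric_generating_set G S"
    and hyp: "gromov_hyperbolic_on (carrier G) (word_metric G S)"
    and nvc: "\<not> virtually_cyclic G"
    using assms(1) unfolding nonelementary_hyperbolic_group_def by blast
  define len where "len x = real (word_length G S x)" for x
  obtain \<delta> where \<delta>: "0 \<le> \<delta>" "\<And>x y z w. x \<in> carrier G \<Longrightarrow> y \<in> carrier G \<Longrightarrow> z \<in> carrier G \<Longrightarrow> w \<in> carrier G \<Longrightarrow>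
      min (gromov_product (word_metric G S) w x y) (gromov_product (word_metric G S) w y z) - \<delta>
        \<le> gromov_product (word_metric G S) w x z"
    using hyp unfolding gromov_hyperbolic_on_def by blast
  have gp: "gromov_product (word_metric G S) \<one>\<^bsub>G\<^esub> x y = length_product G len x y"
    if "x \<in> carrier G" "y \<in> carrier G" for x y
    using gromov_product_word_metric[OF S that] unfolding len_def .
  interpret nonelementary_length_group G len \<delta>
  proof
    show "len \<one>\<^bsub>G\<^esub> = 0" by (simp add: len_def word_length_one[OF S])
    show "len (inv\<^bsub>G\<^esub> x) = len x" if "x \<in> carrier G" for x
      by (simp add: len_def word_length_inv[OF S that])
    show "len (x \<otimes>\<^bsub>G\<^esub> y) \<le> len x + len y" if "x \<in> carrier G" "y \<in> carrier G" for x y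
      using word_length_mult[OF S that] by (simp add: len_def flip: of_nat_add)
    show finite_ball: "finite {x \<in> carrier G. len x \<le> r}" for r
      unfolding len_def by (rule finite_word_ball[OF S])
    show "0 \<le> \<delta>" by (rule \<delta>)
    show "min (length_product G len x y) (length_product G len y z) - \<delta> \<le> length_product G len x z"
      if "x \<in> carrier G" "y \<in> carrier G" "z \<in> carrier G" for x y z
      using \<delta>(2)[OF that one_closed] gp that by simp
    show "\<exists>y\<in>carrier G. \<exists>z\<in>carrier G. x = y \<otimes>\<^bsub>G\<^esub> z \<and> len y = real k \<and> len z = len x - real k"
      if "x \<in> carrier G" "real k \<le> len x" for x k
      using word_length_split[OF S that(1), of k] that(2) unfolding len_def by (fastforce simp: of_nat_diff)
    show "\<exists>x\<in>carrier G. \<forall>m::int. r < len (g [^]\<^bsub>G\<^esub> m \<otimes>\<^bsub>G\<^esub> x)" if g: "g \<in> carrier G" for g r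
    proof (rule ccontr)
      assume "\<not> ?thesis"
      then have "\<exists>m::int. g [^]\<^bsub>G\<^esub> m \<otimes>\<^bsub>G\<^esub> x \<in> {x \<in> carrier G. len x \<le> r}" if "x \<in> carrier G" for x
        using g that by (force simp: not_less)
      from virtually_cyclic_if_near_cyclic_subgroup[OF g finite_ball this] nvc show False by blast
    qed
  qed
  define f where "f i x = \<psi> i \<one>\<^bsub>G\<^esub> x" for i x
  have inv\<psi>: "left_invariant G (\<psi> i)" for i
    using assms(2) by (simp add: hyperbolic_metric_potentials_def)
  have f: "coarsely_additive (f i)" for i
  proof -
    obtain c where c: "0 < c" "\<And>x y w. x \<in> carrier G \<Longrightarrow> y \<in> carrier G \<Longrightarrow> w \<in> carrier G \<Longrightarrow>
        \<bar>gromov_product (\<psi> i) w x y\<bar> \<le> c * gromov_product (word_metric G S) w x y + c"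
      using assms(2)[of i] word_metric_in_hyperbolic_pseudo_metrics[OF S hyp]
      unfolding hyperbolic_metric_potentials_def by blast
    show ?thesis
      unfolding coarsely_additive_def
    proof (intro exI[of _ "2 * c"] conjI ballI)
      show "0 \<le> 2 * c" using c(1) by simp
      fix x y assume xy: "x \<in> carrier G" "y \<in> carrier G"
      have "\<bar>(f i x + f i y - f i (x \<otimes>\<^bsub>G\<^esub> y)) / 2\<bar> \<le> c * length_product G len (inv\<^bsub>G\<^esub> x) y + c"
        using c(2)[of "inv\<^bsub>G\<^esub> x" y "\<one>\<^bsub>G\<^esub>"] xy gp[of "inv\<^bsub>G\<^esub> x" y]
          gromov_product_left_invariant[OF inv\<psi> xy, of i] by (simp add: f_def)
      then show "\<bar>f i (x \<otimes>\<^bsub>G\<^esub> y) - f i x - f i y\<bar> \<le> 2 * c * (1 + length_product G len (inv\<^bsub>G\<^esub> x) y)"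
        by (simp add: abs_le_iff algebra_simps)
    qed
  qed
  have tc: "translation_cone G \<psi> = closure (stable_rays f)"
    unfolding translation_cone_def stable_rays_def
    by (simp add: translation_vector_def stable_vector_def stable_translation_length_def stable_limit_def f_def)
  have pv: "potential_vector G \<psi> = value_vector f"
    by (simp add: fun_eq_iff potential_vector_def value_vector_def f_def)
  have \<psi>f: "\<psi> i x y = f i (inv\<^bsub>G\<^esub> x \<otimes>\<^bsub>G\<^esub> y)" if "x \<in> carrier G" "y \<in> carrier G" for i x y
  proof -
    have "\<psi> i (inv\<^bsub>G\<^esub> x \<otimes>\<^bsub>G\<^esub> x) (inv\<^bsub>G\<^esub> x \<otimes>\<^bsub>G\<^esub> y) = \<psi> i x y"
      using inv\<psi>[of i] that inv_closed unfolding left_invariant_def by blast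
    then show ?thesis using that by (simp add: f_def)
  qed
  have "bdd_above ((\<lambda>(x, y). \<bar>\<Sum>i\<in>UNIV. c i * \<psi> i x y\<bar>) ` (carrier G \<times> carrier G))
      \<longleftrightarrow> (\<exists>B. \<forall>x\<in>carrier G. \<bar>\<Sum>i\<in>UNIV. c i * f i x\<bar> \<le> B)" for c
  proof -
    have "(\<lambda>(x, y). \<bar>\<Sum>i\<in>UNIV. c i * \<psi> i x y\<bar>) ` (carrier G \<times> carrier G)
        = (\<lambda>x. \<bar>\<Sum>i\<in>UNIV. c i * f i x\<bar>) ` carrier G"
    proof (intro equalityI subsetI)
      fix r assume "r \<in> (\<lambda>(x, y). \<bar>\<Sum>i\<in>UNIV. c i * \<psi> i x y\<bar>) ` (carrier G \<times> carrier G)"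
      then show "r \<in> (\<lambda>x. \<bar>\<Sum>i\<in>UNIV. c i * f i x\<bar>) ` carrier G"
        using \<psi>f by auto
    next
      fix r assume "r \<in> (\<lambda>x. \<bar>\<Sum>i\<in>UNIV. c i * f i x\<bar>) ` carrier G"
      then obtain x where "x \<in> carrier G" "r = \<bar>\<Sum>i\<in>UNIV. c i * \<psi> i \<one>\<^bsub>G\<^esub> x\<bar>" by (auto simp: f_def)
      then show "r \<in> (\<lambda>(x, y). \<bar>\<Sum>i\<in>UNIV. c i * \<psi> i x y\<bar>) ` (carrier G \<times> carrier G)"
        by (intro image_eqI[of _ _ "(\<one>\<^bsub>G\<^esub>, x)"]) auto
    qed
    then show ?thesis by (simp add: bdd_above_def)
  qed
  then have "independent_potentials G \<psi> \<longleftrightarrow> interior (closure (stable_rays f)) \<noteq> {}"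
    unfolding interior_stable_rays_iff[of f, OF f] independent_potentials_def by simp
  then show ?thesis
    unfolding tc pv
    using convex_closure_stable_rays[of f, OF f] closure_stable_rays_eq_asymptotic_cone[of f, OF f] by blast
qed

end
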